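(* Let $M$ be an $n$-dimensional topological manifold and let $\mathcal{F}=\{f_i\mid i\in\mathbb{N}\}$ be a set of functions $f_i:M\rightarrow\mathbb{R}$. Suppose $f:M\rightarrow\mathbb{R}$ is given by $f(x)=\min\{f_i(x)\mid f_i\in\mathcal{F}\}$ for all $x\in M$. Suppose also that for every $x\in M$ there are a neighbourhood $N_x$ of $x$, a finite subset $\mathcal{F}_x\subset\mathcal{F}$, and a chart $\varphi:U\rightarrow\varphi(U)\subset\mathbb{R}^n$ of $M$ (a homeomorphism from an open subset $U$ of $M$ onto an open subset of $\mathbb{R}^n$) with $N_x\subset U$, such that $f(y)=\min\{f_i(y)\mid f_i\in\mathcal{F}_x\}$ for all $y\in N_x$, and such that for each $f_i\in\mathcal{F}_x$ the function $f_i\circ\varphi^{-1}$ is a convex function on the open set $\varphi(U)\subset\mathbb{R}^n$. Then $f$ is a topological Morse function.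
   Context: Convex function: a real-valued function on an open subset of $\mathbb{R}^n$ is called convex if it is smooth and its Hessian is positive definite at every point (elsewhere this is called a smooth, strictly convex function). Topological Morse function: let $M$ be an $n$-dimensional topological manifold. A continuous function $f:M\rightarrow\mathbb{R}$ is a topological Morse function if every point of $M$ is either regular or critical with respect to $f$, in the following sense. - A point $x\in M$ is regular if there is an open neighbourhood $U$ of $x$ that admits a homeomorphic parametrisation by $n$ parameters, one of which is $f$ (that is, a homeomorphism from $U$ onto an open subset of $\mathbb{R}^n$, one of whose coordinate functions is $f|_U$). - A point $p\in M$ is critical if there exist an integer $j$ with $0\leq j\leq n$ (called the index of $p$), an open neighbourhood $U$ of $p$, and a homeomorphic parametrisation of $U$ by parameters $\{x_1,\ldots,x_n\}$ (that is, a homeomorphism $(x_1,\ldots,x_n)$ from $U$ onto an open neighbourhood of the origin in $\mathbb{R}^n$, sending $p$ to the origin) such that for every $x\in U$, $$f(x)-f(p)=\sum_{i=1}^{n-j}x_i^2-\sum_{i=n-j+1}^{n}x_i^2 .$$ *)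

theory Defs
  imports "HOL-Analysis.Analysis"
begin

definition chart :: "'a topology \<Rightarrow> 'a set \<Rightarrow> ('a \<Rightarrow> real ^ 'n) \<Rightarrow> bool" where
  "chart X U \<phi> \<longleftrightarrow>
     openin X U \<and> open (\<phi> ` U) \<and>
     homeomorphic_map (subtopology X U) (top_of_set (\<phi> ` U)) \<phi>"

(* The dimension is CARD('n); the second argument only serves to fix the type 'n. *)
definition topological_manifold :: "'a topology \<Rightarrow> 'n::finite itself \<Rightarrow> bool" where
  "topological_manifold X (_ :: 'n itself) \<longleftrightarrow>
     Hausdorff_space X \<and> second_countable X \<and>
     (\<forall>x\<in>topspace X. \<exists>U (\<phi> :: 'a \<Rightarrow> real ^ 'n). chart X U \<phi> \<and> x \<in> U)"

definition partial_deriv :: "'n \<Rightarrow> (real ^ 'n \<Rightarrow> real) \<Rightarrow> real ^ 'n \<Rightarrow> real" where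
  "partial_deriv i g x = frechet_derivative g (at x) (axis i 1)"

(* C^k on S; meant for open S, since derivatives are taken in the whole space. *)
fun Ck_on :: "nat \<Rightarrow> (real ^ 'n) set \<Rightarrow> (real ^ 'n \<Rightarrow> real) \<Rightarrow> bool" where
  "Ck_on 0 S g \<longleftrightarrow> continuous_on S g"
| "Ck_on (Suc k) S g \<longleftrightarrow>
     (\<forall>x\<in>S. g differentiable (at x)) \<and> (\<forall>i. Ck_on k S (partial_deriv i g))"

definition smooth_on :: "(real ^ 'n) set \<Rightarrow> (real ^ 'n \<Rightarrow> real) \<Rightarrow> bool" where
  "smooth_on S g \<longleftrightarrow> (\<forall>k. Ck_on k S g)"

definition hessian :: "(real ^ 'n \<Rightarrow> real) \<Rightarrow> real ^ 'n \<Rightarrow> real ^ 'n ^ 'n" where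
  "hessian g x = (\<chi> i j. partial_deriv i (partial_deriv j g) x)"

(* Symmetry is not required here: it is automatic for Hessians of smooth functions. *)
definition positive_definite :: "real ^ 'n ^ 'n \<Rightarrow> bool" where
  "positive_definite A \<longleftrightarrow> (\<forall>v. v \<noteq> 0 \<longrightarrow> v \<bullet> (A *v v) > 0)"

(* Smooth and strictly convex in the Hessian sense, which differs from convex_on:
   S is open but need not be a convex set. *)
definition convex_function_on :: "(real ^ 'n) set \<Rightarrow> (real ^ 'n \<Rightarrow> real) \<Rightarrow> bool" where
  "convex_function_on S g \<longleftrightarrow>
     open S \<and> smooth_on S g \<and> (\<forall>x\<in>S. positive_definite (hessian g x))"

(* Asserts that the minimum is attained, so A is nonempty; A may be infinite, unlike for Min. *)
definition is_min_of :: "real \<Rightarrow> real set \<Rightarrow> bool" where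
  "is_min_of m A \<longleftrightarrow> m \<in> A \<and> (\<forall>a\<in>A. m \<le> a)"

definition regular_point ::
    "'n::finite itself \<Rightarrow> 'a topology \<Rightarrow> ('a \<Rightarrow> real) \<Rightarrow> 'a \<Rightarrow> bool" where
  "regular_point (_ :: 'n itself) X f x \<longleftrightarrow>
     (\<exists>U (\<phi> :: 'a \<Rightarrow> real ^ 'n) k. chart X U \<phi> \<and> x \<in> U \<and> (\<forall>y\<in>U. \<phi> y $ k = f y))"

(* The type 'n carries no order, so e supplies the numbering x_1, ..., x_n of the coordinates;
   j is the index of p. *)
definition critical_point_of_index ::
    "'n::finite itself \<Rightarrow> 'a topology \<Rightarrow> ('a \<Rightarrow> real) \<Rightarrow> nat \<Rightarrow> 'a \<Rightarrow> bool" where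
  "critical_point_of_index (_ :: 'n itself) X f j p \<longleftrightarrow>
     j \<le> CARD('n) \<and>
     (\<exists>U (\<phi> :: 'a \<Rightarrow> real ^ 'n) e.
        chart X U \<phi> \<and> p \<in> U \<and> \<phi> p = 0 \<and> bij_betw e {1..CARD('n)} UNIV \<and>
        (\<forall>x\<in>U. f x - f p =
           (\<Sum>i = 1..CARD('n) - j. (\<phi> x $ e i)\<^sup>2)
           - (\<Sum>i = CARD('n) - j + 1..CARD('n). (\<phi> x $ e i)\<^sup>2)))"

definition topological_Morse_function ::
    "'n::finite itself \<Rightarrow> 'a topology \<Rightarrow> ('a \<Rightarrow> real) \<Rightarrow> bool" where
  "topological_Morse_function N X f \<longleftrightarrow>
     continuous_map X euclideanreal f \<and>
     (\<forall>x\<in>topspace X. regular_point N X f x \<or> (\<exists>j. critical_point_of_index N X f j x))"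

end

theory Submission
  imports Defs
begin

text \<open>Fix a point, take it to be the origin of a chart with value \<open>0\<close>, and let \<open>g\<^sub>i\<close> be the active
  convex functions with gradients \<open>a\<^sub>i\<close> there. Choose \<open>v\<close> with all \<open>a\<^sub>i \<bullet> v \<ge> 0\<close> and as many strict
  inequalities as possible; let \<open>L\<close> be the span of the \<open>a\<^sub>i\<close> with \<open>a\<^sub>i \<bullet> v = 0\<close>. By maximality, each
  nonzero direction in \<open>L\<close> is a descent direction of one of these.

  By convexity \<open>f\<close> increases along rays from the origin wherever \<open>f \<ge> 0\<close>, even when the rays are bent
  towards \<open>v\<close> by a small logarithmic term. Wherever \<open>f \<le> 0\<close>, it decreases along half-lines with
  direction \<open>e - M v\<close>, \<open>e \<in> L\<close>, starting in the complement of \<open>L\<close>. Following the (bent) rays back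
  to the point where \<open>f\<close> vanishes and using the half-lines as a second system of coordinates gives an
  explicit continuous injection, hence by invariance of domain a chart. If all \<open>a\<^sub>i \<bullet> v = 0\<close> (no bending)
  the point is critical of index \<open>dim L\<close>; otherwise the bending leaves only one curve that reaches the
  origin inside \<open>{f > 0}\<close>, and the point is regular.\<close>

text \<open>A minimum of smooth functions need not be differentiable, so neither the implicit
  function theorem nor the Morse lemma applies; monotonicity is read off the functions active at
  each point instead. Straight rays fail in the regular case: a whole cone of directions around
  \<open>v\<close>, orthogonal to L, stays in {f > 0} down to the origin, and all these rays would
  share the origin as exit point. The term s ln s cures this. As s tends to 0 it vanishes but is
  large compared with s, so off the \<open>v\<close>-axis it overrides every linear slope and drives
  the ray to where a function increasing along \<open>v\<close> is nonpositive. Its contribution to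
  the generator is still of first order only, so a small multiple is absorbed by the quadratic gain
  from strict convexity. On the descent side -M v has a similar task: for a function that increases
  along \<open>v\<close> it outweighs every unit direction e, so only the functions with slope 0
  along \<open>v\<close> have to be controlled through the choice of e.\<close>

section \<open>Monotonicity without differentiability, and continuity at singular points\<close>

lemma strict_decrease_criterion:
  fixes h :: "real \<Rightarrow> real"
  assumes cont: "continuous_on {a..b} h" and "a < b" and "h a \<le> 0"
    and loc: "\<And>s. a \<le> s \<Longrightarrow> s < b \<Longrightarrow> h s \<le> 0 \<Longrightarrow> \<exists>t. s < t \<and> t \<le> b \<and> h t < h s"
  shows "h b < h a"
proof -
  obtain m where m: "m \<in> {a..b}" "\<And>y. y \<in> {a..b} \<Longrightarrow> h m \<le> h y"
    using continuous_attains_inf[OF _ _ cont] \<open>a < b\<close> by auto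
  \<comment> \<open>The minimum value is at most \<open>h a\<close>, hence nonpositive, so the local
    hypothesis applies at a minimiser and excludes every point before \<open>b\<close>.\<close>
  have "m = b"
  proof (rule ccontr)
    assume "m \<noteq> b"
    then obtain t where "m < t" "t \<le> b" "h t < h m"
      using loc[of m] m(1) m(2)[of a] assms(2,3) by fastforce
    then show False using m(1) m(2)[of t] by auto
  qed
  moreover obtain t where "a < t" "t \<le> b" "h t < h a"
    using loc[of a] assms by auto
  ultimately show ?thesis using m(2)[of t] by auto
qed

lemma continuous_on_Min_image:
  fixes g :: "'i \<Rightarrow> 'a::topological_space \<Rightarrow> real"
  assumes "finite I" "I \<noteq> {}" "\<And>i. i \<in> I \<Longrightarrow> continuous_on S (g i)"
  shows "continuous_on S (\<lambda>x. Min ((\<lambda>i. g i x) ` I))"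
  using assms
proof (induction I rule: finite_ne_induct)
  case (singleton i)
  then show ?case by simp
next
  case (insert i I)
  then have "continuous_on S (\<lambda>x. min (g i x) (Min ((\<lambda>i. g i x) ` I)))"
    by (intro continuous_intros) auto
  then show ?case using insert by simp
qed

text \<open>\<open>sgn\<close> jumps at 0, but the scalar factor vanishes there and bounds the norm
  of the product. This is what lets polar coordinates pass through the centre.\<close>

lemma continuous_scaleR_sgn:
  fixes r :: "'a::topological_space \<Rightarrow> real" and y :: "'a \<Rightarrow> 'b::real_normed_vector"
  assumes r: "continuous_on S r" and y: "continuous_on S y"
    and z: "\<And>x. x \<in> S \<Longrightarrow> y x = 0 \<Longrightarrow> r x = 0"
  shows "continuous_on S (\<lambda>x. r x *\<^sub>R sgn (y x))"
  unfolding continuous_on_def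
proof
  fix x assume x: "x \<in> S"
  have rx: "(r \<longlongrightarrow> r x) (at x within S)" and yx: "(y \<longlongrightarrow> y x) (at x within S)"
    using r y x by (auto simp: continuous_on_def)
  show "((\<lambda>x. r x *\<^sub>R sgn (y x)) \<longlongrightarrow> r x *\<^sub>R sgn (y x)) (at x within S)"
  proof (cases "y x = 0")
    case False
    then show ?thesis using rx yx by (intro tendsto_intros) auto
  next
    case True
    then have 0: "r x = 0" using z x by simp
    have "((\<lambda>x. r x *\<^sub>R sgn (y x)) \<longlongrightarrow> 0) (at x within S)"
    proof (rule Lim_null_comparison)
      show "\<forall>\<^sub>F t in at x within S. norm (r t *\<^sub>R sgn (y t)) \<le> \<bar>r t\<bar>"
        by (intro always_eventually) (auto simp: norm_sgn)
      show "((\<lambda>t. \<bar>r t\<bar>) \<longlongrightarrow> 0) (at x within S)"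
        using tendsto_rabs[OF rx] 0 by simp
    qed
    then show ?thesis using 0 by simp
  qed
qed

text \<open>Both bounds come from ln y \<le> y - 1, at y = 1/s and y = 1/sqrt s. The first limits
  how far bending enlarges norms; the second gives continuity at 0 and makes the square of s ln s of
  order s.\<close>

lemma mult_ln_bounds:
  fixes s :: real
  assumes "0 \<le> s" "s \<le> 1"
  shows "\<bar>s * ln s\<bar> \<le> 1" "\<bar>s * ln s\<bar> \<le> 2 * sqrt s"
proof -
  have *: "\<bar>s * ln s\<bar> \<le> 2 * sqrt s \<and> \<bar>s * ln s\<bar> \<le> 1"
  proof (cases "s = 0")
    case False
    then have s: "0 < s" using assms by simp
    have le0: "ln s \<le> 0" using s assms by simp
    have "ln (1 / s) \<le> 1 / s - 1" using s by (intro ln_le_minus_one) auto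
    then have "- ln s \<le> 1 / s" using s by (simp add: ln_div)
    then have "s * (- ln s) \<le> s * (1/s)" using s by (intro mult_left_mono) auto
    then have 1: "- (s * ln s) \<le> 1" using s by simp
    have "ln (1 / sqrt s) \<le> 1 / sqrt s - 1" using s by (intro ln_le_minus_one) auto
    then have "- ln s \<le> 2 / sqrt s" using s by (simp add: ln_div ln_sqrt)
    then have "s * (- ln s) \<le> s * (2 / sqrt s)" using s by (intro mult_left_mono) auto
    also have "s * (2 / sqrt s) = 2 * sqrt s" using s by (simp add: field_simps)
    finally have 2: "- (s * ln s) \<le> 2 * sqrt s" by simp
    have "s * ln s \<le> 0" using s le0 by (simp add: mult_nonneg_nonpos)
    then show ?thesis using 1 2 by (simp add: abs_if)
  qed simp
  then show "\<bar>s * ln s\<bar> \<le> 1" "\<bar>s * ln s\<bar> \<le> 2 * sqrt s" by auto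
qed

lemma continuous_on_mult_ln: "continuous_on {0..1} (\<lambda>s::real. s * ln s)"
  unfolding continuous_on_def
proof
  fix s :: real assume s: "s \<in> {0..1}"
  show "((\<lambda>s. s * ln s) \<longlongrightarrow> s * ln s) (at s within {0..1})"
  proof (cases "s = 0")
    case True
    have "((\<lambda>s. s * ln s) \<longlongrightarrow> 0) (at s within {0..1})"
    proof (rule Lim_null_comparison)
      show "\<forall>\<^sub>F t in at s within {0..1}. norm (t * ln t) \<le> 2 * sqrt t"
        unfolding eventually_at_filter using mult_ln_bounds(2) by (intro always_eventually) auto
      have "((\<lambda>t. 2 * sqrt t) \<longlongrightarrow> 2 * sqrt s) (at s within {0..1})"
        by (intro tendsto_intros)
      then show "((\<lambda>t. 2 * sqrt t) \<longlongrightarrow> 0) (at s within {0..1})" using True by simp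
    qed
    then show ?thesis using True by simp
  next
    case False
    then show ?thesis by (intro tendsto_intros) auto
  qed
qed

section \<open>Minima of convex germs\<close>

lemma scaleR_sgn_eqD:
  fixes u u' :: "'a::real_normed_vector" and a a' :: real
  assumes eq: "a *\<^sub>R sgn u = a' *\<^sub>R sgn u'" and "0 \<le> a" "0 \<le> a'"
    and "u = 0 \<Longrightarrow> a = 0" "u' = 0 \<Longrightarrow> a' = 0"
  shows "a = a'" "a \<noteq> 0 \<Longrightarrow> sgn u = sgn u'"
proof -
  have "norm (a *\<^sub>R sgn u) = a" "norm (a' *\<^sub>R sgn u') = a'"
    using assms(2-5) by (auto simp: norm_sgn)
  then show aa: "a = a'" using eq by simp
  show "a \<noteq> 0 \<Longrightarrow> sgn u = sgn u'" using eq aa by simp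
qed

lemma norm_scaleR_sgn: "norm x *\<^sub>R sgn x = (x::'a::real_normed_vector)"
  by (cases "x = 0") (simp_all add: sgn_div_norm)

text \<open>Here \<open>p\<close> stands for the orthogonal projection onto L. \<open>lower\<close>
  and \<open>euler\<close> are the tangent inequalities of strict convexity between 0 and
  \<open>x\<close>, with the tangent taken at 0 and at \<open>x\<close> respectively.
  \<open>S1\<close> says that subtracting \<open>M *\<^sub>R v\<close> beats any unit vector for the
  functions outside \<open>S0\<close>. In \<open>small\<close>, the first inequality keeps the
  variation of the gradients below the descent slope available on \<open>S0\<close>, and the second
  makes the loss from bending smaller than the gain from convexity.\<close>

locale min_germ =
  fixes I :: "'i set" and g :: "'i \<Rightarrow> 'a::euclidean_space \<Rightarrow> real" and G :: "'i \<Rightarrow> 'a \<Rightarrow> 'a"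
    and S0 :: "'i set" and p :: "'a \<Rightarrow> 'a" and v :: 'a and \<delta> c C \<kappa> M \<eta> :: real
  assumes fin: "finite I" "I \<noteq> {}" "S0 \<subseteq> I"
    and pos: "0 < \<delta>" "0 < c" "0 < C" "0 < \<kappa>" "0 \<le> M" "0 \<le> \<eta>"
    and g0: "\<And>i. i \<in> I \<Longrightarrow> g i 0 = 0"
    and deriv: "\<And>i x. i \<in> I \<Longrightarrow> norm x < \<delta> \<Longrightarrow> (g i has_derivative (\<lambda>h. G i x \<bullet> h)) (at x)"
    and lip: "\<And>i x. i \<in> I \<Longrightarrow> norm x < \<delta> \<Longrightarrow> norm (G i x - G i 0) \<le> C * norm x"
    and lower: "\<And>i x. i \<in> I \<Longrightarrow> norm x < \<delta> \<Longrightarrow> G i 0 \<bullet> x + c * (norm x)\<^sup>2 \<le> g i x"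
    and euler: "\<And>i x. i \<in> I \<Longrightarrow> norm x < \<delta> \<Longrightarrow> g i x + c * (norm x)\<^sup>2 \<le> G i x \<bullet> x"
    and proj: "linear p" "\<And>x. p (p x) = p x" "\<And>x y. p x \<bullet> y = x \<bullet> p y"
    and v: "p v = 0" "v = 0 \<or> norm v = 1"
    and S0: "\<And>i. i \<in> S0 \<Longrightarrow> p (G i 0) = G i 0"
    and S0_neg: "\<And>e. p e = e \<Longrightarrow> norm e = 1 \<Longrightarrow> \<exists>j\<in>S0. G j 0 \<bullet> e \<le> - \<kappa>"
    and S1: "\<And>i x. i \<in> I - S0 \<Longrightarrow> norm x < \<delta> \<Longrightarrow> norm (G i x) < M * (G i x \<bullet> v)"
    and small: "C * \<delta> * (1 + M) \<le> \<kappa> * c / (c + C)" "\<eta> * C < c"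
begin

definition f :: "'a \<Rightarrow> real" where "f x = Min ((\<lambda>i. g i x) ` I)"

text \<open>The logarithmic term makes this a one-parameter group with generator
  \<open>x + \<eta> \<bar>x - (x \<bullet> v) v\<bar> v\<close>; note \<open>0 * ln 0 = 0\<close>.\<close>

definition flow :: "real \<Rightarrow> 'a \<Rightarrow> 'a" where
  "flow s x = s *\<^sub>R x + (\<eta> * (s * ln s) * norm (x - (x \<bullet> v) *\<^sub>R v)) *\<^sub>R v"

lemma f_le: "i \<in> I \<Longrightarrow> f x \<le> g i x"
  unfolding f_def using fin by auto

lemma f_active: obtains i where "i \<in> I" "f x = g i x"
proof -
  have "f x \<in> (\<lambda>i. g i x) ` I" unfolding f_def using fin by (intro Min_in) auto
  then show ?thesis using that by auto
qed

lemma f_greater: "(\<And>i. i \<in> I \<Longrightarrow> a < g i x) \<Longrightarrow> a < f x"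
  by (metis f_active)

lemma f_0 [simp]: "f 0 = 0"
  by (metis f_active g0)

lemma continuous_g: "i \<in> I \<Longrightarrow> continuous_on (ball 0 \<delta>) (g i)"
  by (intro continuous_at_imp_continuous_on ballI has_derivative_continuous[OF deriv]) auto

lemma continuous_f: "continuous_on (ball 0 \<delta>) f"
  unfolding f_def by (intro continuous_on_Min_image fin continuous_g)

lemma upper:
  assumes "i \<in> I" "norm x < \<delta>"
  shows "g i x \<le> G i 0 \<bullet> x + C * (norm x)\<^sup>2"
proof -
  have "(G i x - G i 0) \<bullet> x \<le> norm (G i x - G i 0) * norm x"
    by (rule norm_cauchy_schwarz)
  also have "\<dots> \<le> C * norm x * norm x" by (intro mult_right_mono lip assms) auto
  finally have "(G i x - G i 0) \<bullet> x \<le> C * (norm x)\<^sup>2" by (simp add: power2_eq_square algebra_simps)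
  moreover have "0 \<le> c * (norm x)\<^sup>2" using pos by simp
  ultimately show ?thesis using euler[OF assms] by (simp add: inner_diff_left)
qed

lemma proj_simps [simp]: "p 0 = 0" "p (x + y) = p x + p y" "p (x - y) = p x - p y"
  "p (r *\<^sub>R x) = r *\<^sub>R p x" "p (- x) = - p x" "p (p x) = p x" "p v = 0"
  using proj v by (auto simp: linear_0 linear_add linear_diff linear_scale linear_neg)

lemma continuous_p: "continuous_on S p"
  using proj(1) linear_continuous_on linear_conv_bounded_linear by blast

lemma inner_p_zero: "p e = e \<Longrightarrow> p x = 0 \<Longrightarrow> e \<bullet> x = 0"
  by (metis inner_zero_right proj(3))

lemma S0_v: "i \<in> S0 \<Longrightarrow> G i 0 \<bullet> v = 0"
  using S0 inner_p_zero by simp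

lemma norm_v: "norm v \<le> 1" using v by auto

section \<open>Descent along half-lines where \<open>f\<close> is nonpositive\<close>

lemma slope_error_bound: "C * norm x * (1 + M) < \<kappa> * c / (c + C)" if "norm x < \<delta>"
proof -
  have "C * norm x * (1 + M) < C * \<delta> * (1 + M)"
    using that pos by (intro mult_strict_right_mono mult_strict_left_mono) auto
  then show ?thesis using small by simp
qed

text \<open>If \<^term>\<open>i \<in> S0\<close> is active at a point where \<^term>\<open>f\<close> is nonpositive, then convexity bounds the slope of
  \<^term>\<open>g i\<close> in direction \<^term>\<open>e\<close> by \<open>-c\<bar>x\<bar>\<^sup>2/s\<close> and comparison with a steep \<^term>\<open>g j\<close> bounds it by
  \<open>-\<kappa> + C\<bar>x\<bar>\<^sup>2/s\<close>; a convex combination of the two bounds is a negative constant.\<close>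

lemma active_slope:
  assumes x: "norm x < \<delta>" "x \<noteq> 0" and e: "p e = e" "norm e = 1" and s: "0 \<le> s" "p x = s *\<^sub>R e"
    and i: "i \<in> S0" "f x = g i x" and le: "f x \<le> 0"
  shows "G i 0 \<bullet> e \<le> - (\<kappa> * c / (c + C))"
proof -
  obtain j where j: "j \<in> S0" "G j 0 \<bullet> e \<le> - \<kappa>" using S0_neg e by blast
  have iI: "i \<in> I" and jI: "j \<in> I" using i j fin by auto
  have inner: "G k 0 \<bullet> x = s * (G k 0 \<bullet> e)" if "k \<in> S0" for k
    using proj(3)[of "G k 0" x] S0[OF that] s by simp
  have 1: "s * (G i 0 \<bullet> e) + c * (norm x)\<^sup>2 \<le> 0"
    using lower[OF iI x(1)] i le inner by simp
  have "s * (G i 0 \<bullet> e) + c * (norm x)\<^sup>2 \<le> s * (G j 0 \<bullet> e) + C * (norm x)\<^sup>2"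
    using lower[OF iI x(1)] upper[OF jI x(1)] f_le[OF jI, of x] i j inner by simp
  moreover have "s * (G j 0 \<bullet> e) \<le> s * (- \<kappa>)" using s j by (intro mult_left_mono) auto
  moreover have "0 \<le> c * (norm x)\<^sup>2" using pos by simp
  ultimately have 2: "s * (G i 0 \<bullet> e) \<le> - (s * \<kappa>) + C * (norm x)\<^sup>2" by simp
  have "0 < c * (norm x)\<^sup>2" using pos x by simp
  then have "s \<noteq> 0" using 1 by auto
  then have "0 < s" using s by simp
  have "C * (s * (G i 0 \<bullet> e) + c * (norm x)\<^sup>2) \<le> C * 0"
    using 1 pos by (intro mult_left_mono) auto
  moreover have "c * (s * (G i 0 \<bullet> e)) \<le> c * (- (s * \<kappa>) + C * (norm x)\<^sup>2)"
    using 2 pos by (intro mult_left_mono) auto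
  ultimately have "s * ((c + C) * (G i 0 \<bullet> e)) \<le> s * (- (\<kappa> * c))" by (simp add: algebra_simps)
  then have "(c + C) * (G i 0 \<bullet> e) \<le> - (\<kappa> * c)"
    using \<open>0 < s\<close> mult_le_cancel_left_pos by blast
  then show ?thesis using pos by (simp add: field_simps)
qed

text \<open>For an active function in \<open>S0\<close> the slope bound at 0 survives the passage to
  the gradient at \<open>x\<close>, since the error is at most \<open>C * norm x * (1 + M)\<close>.
  For one outside \<open>S0\<close> the term in \<open>v\<close> alone outweighs
  \<open>e\<close>.\<close>

lemma descent_direction:
  assumes x: "norm x < \<delta>" and e: "p e = e" "norm e = 1" and s: "0 \<le> s" "p x = s *\<^sub>R e"
    and le: "f x \<le> 0"
  obtains i where "i \<in> I" "f x = g i x" "G i x \<bullet> (e - M *\<^sub>R v) < 0"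
proof -
  note done_by = that
  have S0_case: thesis if i: "i \<in> S0" "f x = g i x" "G i 0 \<bullet> e \<le> - (\<kappa> * c / (c + C))" for i
  proof (rule done_by)
    show iI: "i \<in> I" using i fin by auto
    show "f x = g i x" by fact
    have "norm (e - M *\<^sub>R v) \<le> norm e + norm (M *\<^sub>R v)" by (rule norm_triangle_ineq4)
    also have "\<dots> \<le> 1 + M" using e norm_v pos by (simp add: mult_left_le)
    finally have "norm (e - M *\<^sub>R v) \<le> 1 + M" .
    then have "norm (G i x - G i 0) * norm (e - M *\<^sub>R v) \<le> C * norm x * (1 + M)"
      using lip[OF iI x] pos by (intro mult_mono) auto
    then have "(G i x - G i 0) \<bullet> (e - M *\<^sub>R v) \<le> C * norm x * (1 + M)"
      using norm_cauchy_schwarz order_trans by blast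
    also have "\<dots> < \<kappa> * c / (c + C)" using slope_error_bound[OF x] .
    finally show "G i x \<bullet> (e - M *\<^sub>R v) < 0"
      using i(3) S0_v[OF i(1)] by (simp add: inner_diff_left inner_diff_right)
  qed
  show thesis
  proof (cases "x = 0")
    case True
    \<comment> \<open>All functions vanish at the origin and are therefore active, so a steep one
      may be chosen; \<open>active_slope\<close> does not cover this point.\<close>
    obtain j where j: "j \<in> S0" "G j 0 \<bullet> e \<le> - \<kappa>" using S0_neg e by blast
    have "\<kappa> * c / (c + C) \<le> \<kappa>" using pos by (simp add: field_simps)
    then show thesis using S0_case[OF j(1)] j fin(3) True g0[of j] by auto
  next
    case False
    obtain i where i: "i \<in> I" "f x = g i x" by (rule f_active)
    show thesis
    proof (cases "i \<in> S0")
      case True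
      then show thesis using S0_case i active_slope[OF x False e s] le by blast
    next
      case False
      have "G i x \<bullet> e \<le> norm (G i x)" using norm_cauchy_schwarz[of "G i x" e] e by simp
      also have "\<dots> < M * (G i x \<bullet> v)" using S1 i False x by simp
      finally show thesis using done_by i by (simp add: inner_diff_right)
    qed
  qed
qed

text \<open>One descending active function is enough, because \<open>f\<close> lies below it and
  touches it at the current point. As \<open>p \<xi> = 0\<close>, the projection at parameter r is r
  e, so the same \<open>e\<close> serves along the whole half-line.\<close>

lemma f_decreasing:
  assumes e: "p e = e" "norm e = 1" and \<xi>: "p \<xi> = 0" and st: "0 \<le> s" "s < t"
    and ball: "norm (\<xi> + s *\<^sub>R (e - M *\<^sub>R v)) < \<delta>" "norm (\<xi> + t *\<^sub>R (e - M *\<^sub>R v)) < \<delta>"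
    and le: "f (\<xi> + s *\<^sub>R (e - M *\<^sub>R v)) \<le> 0"
  shows "f (\<xi> + t *\<^sub>R (e - M *\<^sub>R v)) < f (\<xi> + s *\<^sub>R (e - M *\<^sub>R v))"
proof -
  define l where "l = (\<lambda>r. \<xi> + r *\<^sub>R (e - M *\<^sub>R v))"
  have in_ball: "norm (l r) < \<delta>" if "s \<le> r" "r \<le> t" for r
  proof -
    define w where "w = (r - s) / (t - s)"
    have w: "0 \<le> w" "w \<le> 1" using that st by (auto simp: w_def)
    have "w * (t - s) = r - s" using st by (simp add: w_def)
    then have "r = (1 - w) * s + w * t" by (simp add: algebra_simps)
    moreover have "\<xi> + ((1 - w) * s + w * t) *\<^sub>R d
        = (1 - w) *\<^sub>R (\<xi> + s *\<^sub>R d) + w *\<^sub>R (\<xi> + t *\<^sub>R d)" for d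
      by (simp add: algebra_simps)
    ultimately have "l r = (1 - w) *\<^sub>R l s + w *\<^sub>R l t" unfolding l_def by metis
    moreover have "l s \<in> ball 0 \<delta>" "l t \<in> ball 0 \<delta>" using ball by (auto simp: l_def)
    ultimately have "l r \<in> ball 0 \<delta>"
      using convexD[OF convex_ball, of "l s" 0 \<delta> "l t" "1 - w" w] w by simp
    then show ?thesis by simp
  qed
  have "f (l t) < f (l s)"
  proof (rule strict_decrease_criterion[of s t "\<lambda>r. f (l r)"])
    have "continuous_on {s..t} l" unfolding l_def by (intro continuous_intros)
    then show "continuous_on {s..t} (\<lambda>r. f (l r))"
      using in_ball by (intro continuous_on_compose2[OF continuous_f]) auto
    show "s < t" "f (l s) \<le> 0" using st le by (auto simp: l_def)
    fix r assume r: "s \<le> r" "r < t" "f (l r) \<le> 0"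
    have "p (l r) = r *\<^sub>R e" using \<xi> e by (simp add: l_def)
    moreover have "norm (l r) < \<delta>" "0 \<le> r" using in_ball[of r] r st by auto
    ultimately obtain i where i: "i \<in> I" "f (l r) = g i (l r)" "G i (l r) \<bullet> (e - M *\<^sub>R v) < 0"
      by (rule_tac descent_direction[of "l r" e r]) (use e r in auto)
    have "(l has_derivative (\<lambda>h. h *\<^sub>R (e - M *\<^sub>R v))) (at r)"
      unfolding l_def by (auto intro!: derivative_eq_intros)
    moreover have "(g i has_derivative (\<lambda>h. G i (l r) \<bullet> h)) (at (l r))"
      using deriv[OF i(1) in_ball[of r]] r by simp
    ultimately have "((\<lambda>r. g i (l r)) has_derivative (\<lambda>h. G i (l r) \<bullet> (h *\<^sub>R (e - M *\<^sub>R v)))) (at r)"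
      using has_derivative_compose by blast
    then have "((\<lambda>r. g i (l r)) has_real_derivative G i (l r) \<bullet> (e - M *\<^sub>R v)) (at r)"
      by (simp add: has_field_derivative_def mult.commute[of _ "G i (l r) \<bullet> (e - M *\<^sub>R v)"] fun_eq_iff)
    from DERIV_neg_dec_right[OF this i(3)] obtain d where
      d: "d > 0" "\<And>h. 0 < h \<Longrightarrow> h < d \<Longrightarrow> g i (l (r + h)) < g i (l r)" by blast
    define h where "h = min (d / 2) (t - r)"
    have "0 < h" "h < d" "r + h \<le> t" using d r by (auto simp: h_def)
    then have "f (l (r + h)) < f (l r)" using d f_le[OF i(1), of "l (r + h)"] i by fastforce
    then show "\<exists>q. r < q \<and> q \<le> t \<and> f (l q) < f (l r)"
      using \<open>0 < h\<close> \<open>r + h \<le> t\<close> by (intro exI[of _ "r + h"]) auto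
  qed
  then show ?thesis by (simp add: l_def)
qed

section \<open>Bent rays and ascent where \<open>f\<close> is nonnegative\<close>

lemma flow_0 [simp]: "flow 0 x = 0" and flow_1 [simp]: "flow 1 x = x"
  and flow_origin [simp]: "flow s 0 = 0"
  by (simp_all add: flow_def)

lemma inner_v_v: "v = 0 \<or> v \<bullet> v = 1"
  using v(2) by (auto simp: norm_eq_1)

lemma inner_v_v_scaleR: "(r * (v \<bullet> v)) *\<^sub>R v = r *\<^sub>R v"
  using inner_v_v by auto

text \<open>Bending happens along \<open>v\<close> only, so the orthogonal part is merely scaled.
  This is why the two logarithms add up in \<open>flow_flow\<close>.\<close>

lemma v_complement_flow:
  "flow s x - (flow s x \<bullet> v) *\<^sub>R v = s *\<^sub>R (x - (x \<bullet> v) *\<^sub>R v)"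
  by (simp add: flow_def inner_add_left scaleR_diff_right scaleR_add_left inner_v_v_scaleR)

lemma flow_flow:
  assumes "0 < s" "0 < t"
  shows "flow s (flow t x) = flow (s * t) x"
proof -
  let ?u = "norm (x - (x \<bullet> v) *\<^sub>R v)"
  have "flow s (flow t x) = s *\<^sub>R flow t x + (\<eta> * (s * ln s) * (t * ?u)) *\<^sub>R v"
    unfolding flow_def[of s "flow t x"] v_complement_flow using assms by simp
  also have "\<dots> = (s * t) *\<^sub>R x + (s * (\<eta> * (t * ln t) * ?u) + \<eta> * (s * ln s) * (t * ?u)) *\<^sub>R v"
    by (simp add: flow_def scaleR_add_left scaleR_add_right)
  also have "s * (\<eta> * (t * ln t) * ?u) + \<eta> * (s * ln s) * (t * ?u) = \<eta> * (s * t * ln (s * t)) * ?u"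
    using assms by (simp add: ln_mult algebra_simps)
  finally show ?thesis by (simp add: flow_def)
qed

lemma norm_v_complement: "norm (x - (x \<bullet> v) *\<^sub>R v) \<le> norm x"
proof -
  have "(norm (x - (x \<bullet> v) *\<^sub>R v))\<^sup>2 = (norm x)\<^sup>2 - (2 - v \<bullet> v) * (x \<bullet> v) * (x \<bullet> v)"
    unfolding power2_norm_eq_inner
    by (simp add: inner_diff_left inner_diff_right inner_commute algebra_simps)
  also have "\<dots> \<le> (norm x)\<^sup>2" using inner_v_v by auto
  finally show ?thesis by (rule power2_le_imp_le) simp
qed

lemma norm_flow: "0 \<le> s \<Longrightarrow> s \<le> 1 \<Longrightarrow> norm (flow s x) \<le> (1 + \<eta>) * norm x"
proof -
  assume s: "0 \<le> s" "s \<le> 1"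
  let ?u = "norm (x - (x \<bullet> v) *\<^sub>R v)"
  have "norm (flow s x) \<le> norm (s *\<^sub>R x) + norm ((\<eta> * (s * ln s) * ?u) *\<^sub>R v)"
    unfolding flow_def by (rule norm_triangle_ineq)
  also have "\<dots> = s * norm x + \<eta> * \<bar>s * ln s\<bar> * ?u * norm v"
    using s pos by (simp add: abs_mult)
  also have "\<dots> \<le> 1 * norm x + \<eta> * 1 * norm x * 1"
    using s pos mult_ln_bounds(1)[OF s] norm_v norm_v_complement[of x]
    by (intro add_mono mult_mono mult_nonneg_nonneg) auto
  finally show ?thesis by (simp add: algebra_simps)
qed

lemma flow_nonzero:
  assumes "0 < s" "x \<noteq> 0"
  shows "flow s x \<noteq> 0"
proof
  assume "flow s x = 0"
  moreover have "flow (1 / s) (flow s x) = x" using assms by (subst flow_flow) auto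
  ultimately show False using assms by simp
qed

lemma continuous_flow:
  assumes "continuous_on S t" "continuous_on S h" "\<And>x. x \<in> S \<Longrightarrow> t x \<in> {0..1}"
  shows "continuous_on S (\<lambda>x. flow (t x) (h x))"
proof -
  have *: "continuous_on S (\<lambda>x. t x * ln (t x))"
    by (rule continuous_on_compose2[OF continuous_on_mult_ln assms(1)]) (use assms(3) in auto)
  have "continuous_on S (\<lambda>x. t x *\<^sub>R h x + (\<eta> * k x * norm (h x - (h x \<bullet> v) *\<^sub>R v)) *\<^sub>R v)"
    if "continuous_on S k" for k
    using that assms(1,2) by (intro continuous_intros)
  from this[OF *] show ?thesis unfolding flow_def .
qed

text \<open>Apart from the factor 1/s, the derivative is the generator evaluated at the point
  reached, so a sign condition at single points controls a whole flow line.\<close>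

lemma has_derivative_flow:
  assumes "0 < s"
  shows "((\<lambda>s. flow s x) has_derivative
    (\<lambda>h. (h / s) *\<^sub>R (flow s x + (\<eta> * norm (flow s x - (flow s x \<bullet> v) *\<^sub>R v)) *\<^sub>R v))) (at s)"
proof -
  let ?u = "norm (x - (x \<bullet> v) *\<^sub>R v)"
  have "((\<lambda>s. \<eta> * (s * ln s) * ?u) has_real_derivative \<eta> * (ln s + 1) * ?u) (at s)"
    using assms by (auto intro!: derivative_eq_intros)
  then have "((\<lambda>s. \<eta> * (s * ln s) * ?u) has_derivative (\<lambda>h. \<eta> * (ln s + 1) * ?u * h)) (at s)"
    by (rule has_field_derivative_imp_has_derivative)
  then have "((\<lambda>s. (\<eta> * (s * ln s) * ?u) *\<^sub>R v) has_derivative (\<lambda>h. (\<eta> * (ln s + 1) * ?u * h) *\<^sub>R v)) (at s)"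
    by (rule has_derivative_scaleR_left)
  then have "((\<lambda>s. flow s x) has_derivative
      (\<lambda>h. h *\<^sub>R x + (\<eta> * (ln s + 1) * ?u * h) *\<^sub>R v)) (at s)"
    unfolding flow_def by (rule has_derivative_add[OF has_derivative_scaleR_left[OF has_derivative_ident]])
  moreover have "h *\<^sub>R x + (\<eta> * (ln s + 1) * ?u * h) *\<^sub>R v =
      (h / s) *\<^sub>R (flow s x + (\<eta> * norm (flow s x - (flow s x \<bullet> v) *\<^sub>R v)) *\<^sub>R v)" for h
  proof -
    define u where "u = norm (x - (x \<bullet> v) *\<^sub>R v)"
    have "norm (flow s x - (flow s x \<bullet> v) *\<^sub>R v) = s * u"
      unfolding v_complement_flow u_def using assms by simp
    moreover have "flow s x = s *\<^sub>R x + (\<eta> * (s * ln s) * u) *\<^sub>R v" by (simp add: flow_def u_def)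
    ultimately show ?thesis
      unfolding u_def[symmetric] using assms
      by (simp add: scaleR_add_right flip: scaleR_add_left) (simp add: algebra_simps add_divide_distrib)
  qed
  ultimately show ?thesis by simp
qed

text \<open>Convexity makes the radial slope at least c|x|^2. Outside \<open>S0\<close> the bending
  term only helps. In \<open>S0\<close> the slope along \<open>v\<close> vanishes at 0, so that term
  costs at most \<eta> C |x|^2, which is less.\<close>

lemma ascent_direction:
  assumes i: "i \<in> I" and x: "norm x < \<delta>" "x \<noteq> 0" and ge: "0 \<le> g i x"
  shows "0 < G i x \<bullet> (x + (\<eta> * norm (x - (x \<bullet> v) *\<^sub>R v)) *\<^sub>R v)"
proof -
  let ?u = "norm (x - (x \<bullet> v) *\<^sub>R v)"
  have 0: "0 < (norm x)\<^sup>2" using x by simp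
  have "- (\<eta> * C * (norm x)\<^sup>2) \<le> \<eta> * ?u * (G i x \<bullet> v)"
  proof (cases "i \<in> S0")
    case True
    have "- (G i x \<bullet> v) = - ((G i x - G i 0) \<bullet> v)" using S0_v[OF True] by (simp add: inner_diff_left)
    also have "\<dots> \<le> norm (G i x - G i 0) * norm v"
      using norm_cauchy_schwarz[of "- (G i x - G i 0)" v] by (simp only: inner_minus_left norm_minus_cancel)
    also have "\<dots> \<le> (C * norm x) * 1" using lip[OF i x(1)] norm_v pos by (intro mult_mono) auto
    finally have "?u * (- (G i x \<bullet> v)) \<le> ?u * (C * norm x)"
      by (intro mult_left_mono) auto
    also have "\<dots> \<le> norm x * (C * norm x)"
      using norm_v_complement[of x] pos by (intro mult_right_mono) auto
    finally have "?u * (- (G i x \<bullet> v)) \<le> norm x * (C * norm x)" .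
    then have "\<eta> * (?u * (- (G i x \<bullet> v))) \<le> \<eta> * (norm x * (C * norm x))"
      using pos by (intro mult_left_mono) auto
    then show ?thesis by (simp add: power2_eq_square algebra_simps)
  next
    case False
    have "0 < M * (G i x \<bullet> v)" using S1[of i x] i False x by (auto intro: le_less_trans[OF norm_ge_zero])
    then have "0 < G i x \<bullet> v" using pos by (simp add: zero_less_mult_iff)
    then have "0 \<le> \<eta> * ?u * (G i x \<bullet> v)" using pos by simp
    moreover have "0 \<le> \<eta> * C * (norm x)\<^sup>2" using pos by simp
    ultimately show ?thesis by simp
  qed
  moreover have "\<eta> * C * (norm x)\<^sup>2 < c * (norm x)\<^sup>2" using small(2) 0 by (intro mult_strict_right_mono)
  ultimately show ?thesis using euler[OF i x(1)] ge by (simp add: inner_add_right)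
qed

text \<open>Every \<open>g i\<close>, active or not, has to end above the initial value of
  \<open>f\<close>. Each starts at or above that value, hence nonnegative, and then rises; the
  decrease criterion is applied to its negative.\<close>

lemma f_increasing:
  assumes x: "x \<noteq> 0" and st: "0 < s" "s < t"
    and ball: "\<And>r. s \<le> r \<Longrightarrow> r \<le> t \<Longrightarrow> norm (flow r x) < \<delta>"
    and ge: "0 \<le> f (flow s x)"
  shows "f (flow s x) < f (flow t x)"
proof (rule f_greater)
  fix i assume i: "i \<in> I"
  define h where "h = (\<lambda>r. - g i (flow r x))"
  have "h t < h s"
  proof (rule strict_decrease_criterion[of s t h])
    have "((\<lambda>r. flow r x) has_derivative
      (\<lambda>h. (h / r) *\<^sub>R (flow r x + (\<eta> * norm (flow r x - (flow r x \<bullet> v) *\<^sub>R v)) *\<^sub>R v))) (at r)"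
      if "s \<le> r" for r using that st by (intro has_derivative_flow) auto
    then have "continuous_on {s..t} (\<lambda>r. flow r x)"
      by (intro continuous_at_imp_continuous_on ballI) (auto dest!: has_derivative_continuous)
    then show "continuous_on {s..t} h"
      unfolding h_def using ball
      by (intro continuous_intros continuous_on_compose2[OF continuous_g[OF i]]) auto
    show "s < t" "h s \<le> 0" using st ge f_le[OF i, of "flow s x"] by (auto simp: h_def)
    fix r assume r: "s \<le> r" "r < t" "h r \<le> 0"
    let ?d = "flow r x + (\<eta> * norm (flow r x - (flow r x \<bullet> v) *\<^sub>R v)) *\<^sub>R v"
    have r0: "0 < r" using r st by simp
    have nr: "norm (flow r x) < \<delta>" using ball r by simp
    have "((\<lambda>r. g i (flow r x)) has_derivative (\<lambda>h. G i (flow r x) \<bullet> ((h / r) *\<^sub>R ?d))) (at r)"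
      using has_derivative_compose[OF has_derivative_flow[OF r0] deriv[OF i nr]] .
    then have "((\<lambda>r. g i (flow r x)) has_real_derivative (G i (flow r x) \<bullet> ?d) / r) (at r)"
      by (rule has_derivative_imp_has_field_derivative) (simp add: mult.commute)
    moreover have "0 < (G i (flow r x) \<bullet> ?d) / r"
      using ascent_direction[OF i nr flow_nonzero[OF r0 x]] r r0 by (simp add: h_def)
    ultimately obtain d where
      d: "d > 0" "\<And>h. 0 < h \<Longrightarrow> h < d \<Longrightarrow> g i (flow r x) < g i (flow (r + h) x)"
      using DERIV_pos_inc_right by blast
    define q where "q = min (d / 2) (t - r)"
    have "0 < q" "q < d" "r + q \<le> t" using d r by (auto simp: q_def)
    then show "\<exists>q. r < q \<and> q \<le> t \<and> h q < h r"
      using d(2)[of q] by (intro exI[of _ "r + q"]) (auto simp: h_def)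
  qed
  then show "f (flow s x) < g i (flow t x)" using f_le[OF i, of "flow s x"] by (simp add: h_def)
qed

lemma same_flow_line_eq:
  assumes x: "x \<noteq> 0" and t: "0 < t" and ball: "norm x < \<delta> / (1 + \<eta>)" "norm (flow t x) < \<delta> / (1 + \<eta>)"
    and ge: "0 \<le> f x" and eq: "f (flow t x) = f x"
  shows "flow t x = x"
proof -
  have in_ball: "norm (flow r y) < \<delta>" if "0 \<le> r" "r \<le> 1" "norm y < \<delta> / (1 + \<eta>)" for r y
    using norm_flow[OF that(1,2), of y] that(3) pos by (simp add: field_simps)
  consider "t < 1" | "t = 1" | "1 < t" by linarith
  then show ?thesis
  proof cases
    case 1
    then have "f (flow t x) < f (flow 1 x)"
      using ball t eq ge by (intro f_increasing[OF x]) (auto intro!: in_ball)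
    then show ?thesis using eq by simp
  next
    case 3
    have "norm (flow r x) < \<delta>" if "1 \<le> r" "r \<le> t" for r
    proof -
      \<comment> \<open>Intermediate points are reached from the outer end with a parameter in
        [0,1], where \<open>norm_flow\<close> applies.\<close>
      have "flow r x = flow (r / t) (flow t x)" using that t by (subst flow_flow) auto
      then show ?thesis using in_ball[of "r / t" "flow t x"] ball that t by simp
    qed
    then have "f (flow 1 x) < f (flow t x)"
      using 3 ge by (intro f_increasing[OF x]) auto
    then show ?thesis using eq by simp
  qed simp
qed

section \<open>Exit times and exit points of bent rays\<close>

text \<open>The set contains 0, since every flow line starts at the origin. For nonzero
  \<open>x\<close> in the smaller ball, \<open>f\<close> is negative at all parameters strictly
  between 0 and this supremum (\<open>before_exit\<close>), so no earlier sign change is hidden.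
  Where \<open>f x \<le> 0\<close> the value is 1 and the exit point is \<open>x\<close>
  itself.\<close>

definition exit_time :: "'a \<Rightarrow> real" where
  "exit_time x = Sup {s \<in> {0..1}. f (flow s x) \<le> 0}"

definition exit_point :: "'a \<Rightarrow> 'a" where
  "exit_point x = flow (exit_time x) x"

lemma flow_in_ball:
  assumes "norm x < \<delta> / (1 + \<eta>)" "0 \<le> s" "s \<le> 1"
  shows "norm (flow s x) < \<delta>"
  using norm_flow[OF assms(2,3), of x] assms(1) pos by (simp add: field_simps)

lemma continuous_f_flow:
  assumes "norm x < \<delta> / (1 + \<eta>)"
  shows "continuous_on {0..1} (\<lambda>s. f (flow s x))"
proof (rule continuous_on_compose2[OF continuous_f])
  show "continuous_on {0..1} (\<lambda>s. flow s x)"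
    by (rule continuous_flow) (auto intro: continuous_intros)
qed (use flow_in_ball[OF assms] in auto)

lemma exit_time:
  assumes x: "norm x < \<delta> / (1 + \<eta>)"
  shows "exit_time x \<in> {0..1}" "f (exit_point x) \<le> 0"
    and "\<And>s. s \<in> {0..1} \<Longrightarrow> f (flow s x) \<le> 0 \<Longrightarrow> s \<le> exit_time x"
proof -
  let ?A = "{s \<in> {0..1}. f (flow s x) \<le> 0}"
  have "?A = {0..1} \<inter> (\<lambda>s. f (flow s x)) -` {..0}" by auto
  moreover have "closed ({0..1} \<inter> (\<lambda>s. f (flow s x)) -` {..0})"
    by (rule continuous_closed_preimage[OF continuous_f_flow[OF x]]) auto
  ultimately have "closed ?A" by simp
  moreover have bdd: "bdd_above ?A" by (auto intro: bdd_aboveI[of _ 1])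
  moreover have "0 \<in> ?A" by simp
  ultimately have "exit_time x \<in> ?A"
    unfolding exit_time_def using closed_contains_Sup[of ?A] by blast
  then show "exit_time x \<in> {0..1}" "f (exit_point x) \<le> 0" by (auto simp: exit_point_def)
  show "\<And>s. s \<in> {0..1} \<Longrightarrow> f (flow s x) \<le> 0 \<Longrightarrow> s \<le> exit_time x"
    unfolding exit_time_def using bdd by (intro cSup_upper) auto
qed

lemma exit_point_of_nonpos:
  assumes "norm x < \<delta> / (1 + \<eta>)" "f x \<le> 0"
  shows "exit_point x = x"
proof -
  have "1 \<le> exit_time x" using exit_time(3)[OF assms(1), of 1] assms(2) by simp
  then show ?thesis using exit_time(1)[OF assms(1)] by (simp add: exit_point_def)
qed

lemma f_exit_point:
  assumes x: "norm x < \<delta> / (1 + \<eta>)" and pos: "0 \<le> f x"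
  shows "f (exit_point x) = 0"
proof (rule antisym)
  show "f (exit_point x) \<le> 0" by (rule exit_time[OF x])
  show "0 \<le> f (exit_point x)"
  proof (rule ccontr)
    assume neg: "\<not> 0 \<le> f (exit_point x)"
    note et = exit_time(1)[OF x]
    have "\<exists>s. exit_time x \<le> s \<and> s \<le> 1 \<and> f (flow s x) = 0"
      using neg pos et
      by (intro IVT' continuous_on_subset[OF continuous_f_flow[OF x]]) (auto simp: exit_point_def)
    then obtain s where s: "exit_time x \<le> s" "s \<le> 1" "f (flow s x) = 0" by blast
    then have "s = exit_time x" using exit_time(3)[OF x, of s] et by force
    then show False using neg s by (simp add: exit_point_def)
  qed
qed

lemma norm_exit_point:
  assumes "norm x < \<delta> / (1 + \<eta>)"
  shows "norm (exit_point x) \<le> (1 + \<eta>) * norm x" "norm (exit_point x) < \<delta>"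
  unfolding exit_point_def using exit_time(1)[OF assms] norm_flow flow_in_ball[OF assms] by auto

lemma exit_point_0 [simp]: "exit_point 0 = 0"
  by (simp add: exit_point_def)

lemma exit_time_pos:
  assumes "norm x < \<delta> / (1 + \<eta>)" "s \<in> {0<..1}" "f (flow s x) \<le> 0"
  shows "0 < exit_time x"
  using exit_time(3)[OF assms(1), of s] assms by auto

lemma before_exit:
  assumes x: "norm x < \<delta> / (1 + \<eta>)" "x \<noteq> 0" and s: "0 < s" "s < exit_time x"
  shows "f (flow s x) < 0"
proof (rule ccontr)
  assume "\<not> f (flow s x) < 0"
  then have "f (flow s x) < f (flow (exit_time x) x)"
    using s exit_time(1)[OF x(1)] by (intro f_increasing x flow_in_ball) auto
  then show False using exit_time(2)[OF x(1)] \<open>\<not> f (flow s x) < 0\<close> by (simp add: exit_point_def)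
qed

lemma after_exit:
  assumes x: "norm x < \<delta> / (1 + \<eta>)" "x \<noteq> 0" and s: "0 < s" "s \<le> 1" "0 \<le> f (flow s x)"
  shows "exit_time x \<le> s"
proof (rule ccontr)
  assume "\<not> exit_time x \<le> s"
  then show False using before_exit[OF x s(1)] s(3) by simp
qed

text \<open>Away from the origin \<open>f\<close> is negative before and positive after the exit
  time, and nearby points inherit both open conditions. At the origin the exit time may jump, but
  the exit point is bounded by a multiple of the norm.\<close>

lemma continuous_exit_point: "continuous_on (ball 0 (\<delta> / (1 + \<eta>))) exit_point"
  unfolding continuous_on_def
proof
  let ?B = "ball 0 (\<delta> / (1 + \<eta>)) :: 'a set"
  fix x assume xB: "x \<in> ?B"
  then have nx: "norm x < \<delta> / (1 + \<eta>)" by simp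
  show "(exit_point \<longlongrightarrow> exit_point x) (at x within ?B)"
  proof (cases "x = 0")
    case True
    have "(exit_point \<longlongrightarrow> 0) (at x within ?B)"
    proof (rule Lim_null_comparison)
      show "\<forall>\<^sub>F y in at x within ?B. norm (exit_point y) \<le> (1 + \<eta>) * norm y"
        unfolding eventually_at_filter using norm_exit_point by (intro always_eventually) auto
      have "((\<lambda>y. (1 + \<eta>) * norm y) \<longlongrightarrow> (1 + \<eta>) * norm x) (at x within ?B)"
        by (intro tendsto_intros)
      then show "((\<lambda>y. (1 + \<eta>) * norm y) \<longlongrightarrow> 0) (at x within ?B)" using True by simp
    qed
    then show ?thesis using True by simp
  next
    case False
    have near: "\<forall>\<^sub>F y in at x within ?B. y \<in> ?B \<and> y \<noteq> 0"
      using tendsto_imp_eventually_ne[OF tendsto_ident_at False, of ?B]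
      by (auto simp: eventually_at_filter elim!: eventually_mono)
    have f_flow: "((\<lambda>y. f (flow s y)) \<longlongrightarrow> f (flow s x)) (at x within ?B)" if "s \<in> {0..1}" for s
    proof -
      have "continuous_on ?B (\<lambda>y. flow s y)"
        using that by (intro continuous_flow) (auto intro: continuous_intros)
      then have "continuous_on ?B (\<lambda>y. f (flow s y))"
        using that flow_in_ball by (intro continuous_on_compose2[OF continuous_f]) auto
      then show ?thesis using xB by (simp add: continuous_on_def)
    qed
    have "(exit_time \<longlongrightarrow> exit_time x) (at x within ?B)"
    proof (rule order_tendstoI)
      fix a assume "a < exit_time x"
      show "\<forall>\<^sub>F y in at x within ?B. a < exit_time y"
      proof (cases "a < 0")
        case True
        show ?thesis using near
        proof eventually_elim
          case (elim y)
          then show ?case using exit_time(1)[of y] True by simp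
        qed
      next
        case a: False
        then obtain s where s: "a < s" "s < exit_time x" using \<open>a < exit_time x\<close> dense by blast
        then have s01: "s \<in> {0..1}" "0 < s" using a exit_time(1)[OF nx] by auto
        have "f (flow s x) < 0" using before_exit[OF nx False] s s01 by simp
        then have "\<forall>\<^sub>F y in at x within ?B. f (flow s y) < 0"
          using order_tendstoD(2)[OF f_flow[OF s01(1)]] by blast
        then show ?thesis using near
        proof eventually_elim
          case (elim y)
          then have "s \<le> exit_time y" using exit_time(3)[of y s] s01 by auto
          then show ?case using s by simp
        qed
      qed
    next
      fix a assume "exit_time x < a"
      show "\<forall>\<^sub>F y in at x within ?B. exit_time y < a"
      proof (cases "1 < a")
        case True
        show ?thesis using near
        proof eventually_elim
          case (elim y)
          then show ?case using exit_time(1)[of y] True by simp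
        qed
      next
        case a: False
        obtain s where s: "exit_time x < s" "s < a" using \<open>exit_time x < a\<close> dense by blast
        then have s01: "s \<in> {0..1}" "0 < s" using a exit_time(1)[OF nx] by auto
        have "0 < f (flow s x)" using exit_time(3)[OF nx s01(1)] s by force
        then have "\<forall>\<^sub>F y in at x within ?B. 0 < f (flow s y)"
          using order_tendstoD(1)[OF f_flow[OF s01(1)]] by blast
        then show ?thesis using near
        proof eventually_elim
          case (elim y)
          then have "exit_time y \<le> s" using after_exit[of y s] s01 by auto
          then show ?case using s by simp
        qed
      qed
    qed
    moreover have "((\<lambda>y. y) \<longlongrightarrow> x) (at x within ?B)" by (rule tendsto_ident_at)
    ultimately have lim: "((\<lambda>y. (exit_time y, y)) \<longlongrightarrow> (exit_time x, x)) (at x within ?B)"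
      by (rule tendsto_Pair)
    have cont: "continuous_on ({0..1} \<times> UNIV) (\<lambda>q. flow (fst q) (snd q))"
      by (rule continuous_flow) (auto intro: continuous_intros)
    have ev: "\<forall>\<^sub>F y in at x within ?B. (exit_time y, y) \<in> {0..1} \<times> UNIV"
      using near exit_time(1) by (auto elim!: eventually_mono)
    have "(exit_time x, x) \<in> {0..1} \<times> UNIV" using exit_time(1)[OF nx] by simp
    from continuous_on_tendsto_compose[OF cont lim this ev]
    show ?thesis by (simp add: exit_point_def[abs_def])
  qed
qed

section \<open>Coordinates near critical and regular points\<close>

lemma proj_sgn: "p (sgn (p x)) = sgn (p x)" "p (sgn (x - p x)) = 0"
  by (simp_all add: sgn_div_norm)

lemma norm_p: "norm (p x) \<le> norm x"
proof -
  have "norm (p x) * norm (p x) = p x \<bullet> x"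
    using proj(3)[of "p x" x] by (simp add: norm_eq_sqrt_inner)
  also have "\<dots> \<le> norm (p x) * norm x" by (rule norm_cauchy_schwarz)
  finally show ?thesis by (cases "p x = 0") auto
qed

lemma radius_le: "\<delta> / (1 + \<eta>) \<le> \<delta>"
  using pos by (simp add: field_simps)

lemma line_eq:
  assumes "p e = e" "norm e = 1" "p \<xi> = 0" "0 \<le> s" "0 \<le> s'"
    and x: "x = \<xi> + s *\<^sub>R (e - M *\<^sub>R v)" "x' = \<xi> + s' *\<^sub>R (e - M *\<^sub>R v)"
    and "norm x < \<delta>" "norm x' < \<delta>" "f x = f x'" "f x \<le> 0"
  shows "x = x'"
  using f_decreasing[of e \<xi> s s'] f_decreasing[of e \<xi> s' s] assms
  by (cases s s' rule: linorder_cases) auto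

text \<open>A nonzero exit point is reached at positive times, so the group law can be inverted and
  places both points on one flow line, along which \<open>f\<close> is injective where nonnegative.
  An exit point at the origin loses this information and needs separate treatment.\<close>

lemma exit_point_eqD:
  assumes x: "norm x < \<delta> / (1 + \<eta>)" "norm x' < \<delta> / (1 + \<eta>)"
    and eq: "exit_point x = exit_point x'" "exit_point x \<noteq> 0"
    and f: "f x = f x'" "0 \<le> f x"
  shows "x = x'"
proof -
  have t: "0 < exit_time x" "0 < exit_time x'"
    using exit_time(1)[OF x(1)] exit_time(1)[OF x(2)] eq
    by (auto simp: exit_point_def less_le)
  then have "x' = flow (1 / exit_time x') (flow (exit_time x') x')"
    by (subst flow_flow) auto
  also have "\<dots> = flow (1 / exit_time x') (flow (exit_time x) x)"
    using eq by (simp add: exit_point_def)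
  also have "\<dots> = flow (exit_time x / exit_time x') x"
    using t by (subst flow_flow) auto
  finally have x': "x' = flow (exit_time x / exit_time x') x" .
  have "x \<noteq> 0" using eq by auto
  then have "flow (exit_time x / exit_time x') x = x"
    using x t f x' by (intro same_flow_line_eq) auto
  then show ?thesis using x' by simp
qed

text \<open>The model \<open>\<bar>Z\<bar>\<^sup>2 - \<bar>Y\<bar>\<^sup>2\<close> with \<open>Y\<close> in the range of \<^term>\<open>p\<close>: where \<^term>\<open>f\<close> is nonpositive, \<open>Z\<close> is kept and
  only the length of \<open>Y\<close> is adjusted; where \<^term>\<open>f\<close> is positive, the directions of \<open>Y\<close> and \<open>Z\<close> are kept
  and the length of \<open>Y\<close> is read off the point at which the ray to the origin leaves \<open>{f > 0}\<close>.\<close>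

lemma critical_coordinates:
  assumes all: "S0 = I" and v0: "v = 0"
  obtains \<Phi> :: "'a \<Rightarrow> 'a" where
    "continuous_on (ball 0 (\<delta> / (1 + \<eta>))) \<Phi>" "inj_on \<Phi> (ball 0 (\<delta> / (1 + \<eta>)))" "\<Phi> 0 = 0"
    "\<And>x. x \<in> ball 0 (\<delta> / (1 + \<eta>)) \<Longrightarrow> f x = (norm (\<Phi> x - p (\<Phi> x)))\<^sup>2 - (norm (p (\<Phi> x)))\<^sup>2"
proof -
  define z where "z = (\<lambda>x. x - p x)"
  define b where "b = exit_point"
  \<comment> \<open>\<open>min\<close> and \<open>max\<close> let one formula serve both signs of
    \<open>f\<close>: always Z^2 - R^2 = f. For \<open>f x \<le> 0\<close> the exit point is
    \<open>x\<close>, so \<open>Z x\<close> is the length of \<open>z x\<close>; for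
    \<open>f x \<ge> 0\<close>, \<open>R x\<close> is the length of \<open>z (b x)\<close>.\<close>
  define R where "R = (\<lambda>x. sqrt ((norm (z (b x)))\<^sup>2 - min (f x) 0))"
  define Z where "Z = (\<lambda>x. sqrt ((norm (z (b x)))\<^sup>2 + max (f x) 0))"
  define \<Phi> where "\<Phi> = (\<lambda>x. R x *\<^sub>R sgn (p x) + Z x *\<^sub>R sgn (z x))"
  let ?r = "\<delta> / (1 + \<eta>)"
  have flow_eq: "flow s x = s *\<^sub>R x" for s x using flow_def[of s x] unfolding v0[THEN arg_cong, of "\<lambda>v. q *\<^sub>R v" for q] by simp
  have r_le: "norm x < \<delta>" if "norm x < ?r" for x using that radius_le by simp
  have S0_inner: "G i 0 \<bullet> x = G i 0 \<bullet> p x" if "i \<in> I" for i x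
    using S0[of i] proj(3)[of "G i 0" x] that all by simp
  \<comment> \<open>On the kernel of \<open>p\<close> the linear parts vanish and the quadratic
    lower bound remains.\<close>
  have f_pos: "0 < f x" if "norm x < \<delta>" "p x = 0" "x \<noteq> 0" for x
  proof (rule f_greater)
    fix i assume i: "i \<in> I"
    have "0 < c * (norm x)\<^sup>2" using pos that by simp
    then show "0 < g i x" using lower[OF i that(1)] S0_inner[OF i, of x] that by simp
  qed
  \<comment> \<open>A nonzero point in the range of \<open>p\<close> lies on a half-line that starts
    at the origin, where \<open>f\<close> is 0, and along which \<open>f\<close> decreases.\<close>
  have f_neg: "f x < 0" if "norm x < \<delta>" "p x = x" "x \<noteq> 0" for x
  proof -
    have "x = norm x *\<^sub>R sgn x" using that by (simp add: sgn_div_norm)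
    moreover have "p (sgn x) = sgn x" using proj_sgn(1)[of x] that by simp
    ultimately show ?thesis
      using f_decreasing[of "sgn x" 0 0 "norm x"] that pos v0 by (simp add: norm_sgn)
  qed
  have exit_zero: "b x = 0" if "norm x < ?r" "p x = 0" for x
  proof (rule ccontr)
    assume "b x \<noteq> 0"
    moreover have "p (b x) = 0" using that by (simp add: b_def exit_point_def flow_eq)
    ultimately have "0 < f (b x)" using f_pos norm_exit_point[OF that(1)] by (simp add: b_def)
    then show False using exit_time(2)[OF that(1)] by (simp add: b_def)
  qed
  have exit_nonzero: "b x \<noteq> 0" "0 < exit_time x" if x: "norm x < ?r" "p x \<noteq> 0" for x
  proof -
    obtain j where j: "j \<in> I" "G j 0 \<bullet> sgn (p x) \<le> - \<kappa>"
      using S0_neg[of "sgn (p x)"] x all by (auto simp: proj_sgn norm_sgn)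
    have "G j 0 \<bullet> x = norm (p x) * (G j 0 \<bullet> sgn (p x))"
      using S0_inner[OF j(1), of x] x by (simp add: sgn_div_norm)
    also have "\<dots> \<le> norm (p x) * (- \<kappa>)" using j by (intro mult_left_mono) auto
    finally have Gx: "G j 0 \<bullet> x \<le> - (\<kappa> * norm (p x))" by (simp add: mult.commute)
    have nx: "x \<noteq> 0" using x by auto
    \<comment> \<open>For this t the quadratic term of \<open>g j\<close> is outweighed by its
      linear term, whose slope is at most -\<kappa>|p x|, so the ray meets {f \<le> 0} at a positive
      time.\<close>
    define t where "t = min 1 (\<kappa> * norm (p x) / (C * (norm x)\<^sup>2))"
    have t: "0 < t" "t \<le> 1" "t * (C * (norm x)\<^sup>2) \<le> \<kappa> * norm (p x)"
      using pos x nx by (auto simp: t_def min_def field_simps)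
    have "f (t *\<^sub>R x) \<le> G j 0 \<bullet> (t *\<^sub>R x) + C * (norm (t *\<^sub>R x))\<^sup>2"
    proof (rule order_trans[OF f_le[OF j(1)] upper[OF j(1)]])
      show "norm (t *\<^sub>R x) < \<delta>" using flow_in_ball[OF x(1), of t] t by (simp add: flow_eq)
    qed
    also have "\<dots> = t * (G j 0 \<bullet> x + t * (C * (norm x)\<^sup>2))"
      by (simp add: power_mult_distrib power2_eq_square algebra_simps)
    also have "\<dots> \<le> t * 0" using t Gx by (intro mult_left_mono) auto
    finally have "f (flow t x) \<le> 0" by (simp add: flow_eq)
    then show et: "0 < exit_time x" using exit_time_pos[OF x(1), of t] t by simp
    then show "b x \<noteq> 0" using nx by (simp add: b_def exit_point_def flow_eq)
  qed
  have zb: "z (b x) = exit_time x *\<^sub>R z x" "p (b x) = exit_time x *\<^sub>R p x" for x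
    by (simp_all add: z_def b_def exit_point_def flow_eq scaleR_diff_right)
  have b_nonpos: "b x = x" if "norm x < ?r" "f x \<le> 0" for x
    using exit_point_of_nonpos[OF that] by (simp add: b_def)
  have b_0: "b 0 = 0" by (simp add: b_def)
  have R_zero: "R x = 0" if "norm x < ?r" "p x = 0" for x
  proof -
    have "0 \<le> f x" using f_pos[OF r_le] that by (cases "x = 0") (auto intro: less_imp_le)
    then show ?thesis using exit_zero[OF that] by (simp add: R_def z_def)
  qed
  have f_nonpos: "f x \<le> 0" if "norm x < ?r" "z x = 0" for x
    using f_neg[OF r_le[OF that(1)]] that(2) by (cases "x = 0") (auto simp: z_def)
  have Z_zero: "Z x = 0" if "norm x < ?r" "z x = 0" for x
    using f_nonpos[OF that] b_nonpos[OF that(1)] that by (simp add: Z_def)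
  have R_pos: "0 < R x" if x: "norm x < ?r" "p x \<noteq> 0" for x
  proof (cases "f x < 0")
    case True
    then show ?thesis by (simp add: R_def add_nonneg_pos diff_conv_add_uminus min_def
          del: add_uminus_conv_diff)
  next
    case False
    have "f (b x) = 0" using f_exit_point[OF x(1)] False by (simp add: b_def)
    \<comment> \<open>Otherwise the exit point would be a nonzero point in the range of
      \<open>p\<close>, where \<open>f\<close> is negative and not 0.\<close>
    then have "z (b x) \<noteq> 0"
      using f_neg[of "b x"] exit_nonzero[OF x] norm_exit_point[OF x(1)] by (auto simp: z_def b_def)
    then show ?thesis using False by (simp add: R_def)
  qed
  have nonneg: "0 \<le> (norm (z (b x)))\<^sup>2 - min (f x) 0" "0 \<le> (norm (z (b x)))\<^sup>2 + max (f x) 0" for x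
    using zero_le_power2[of "norm (z (b x))"] by linarith+
  then have RZ_nonneg: "0 \<le> R x" "0 \<le> Z x" for x by (simp_all add: R_def Z_def)
  have f_RZ: "f x = (Z x)\<^sup>2 - (R x)\<^sup>2" for x
    using nonneg[of x] by (simp add: R_def Z_def)
  have p_\<Phi>: "p (\<Phi> x) = R x *\<^sub>R sgn (p x)" "\<Phi> x - p (\<Phi> x) = Z x *\<^sub>R sgn (z x)" for x
    using proj_sgn by (auto simp: \<Phi>_def z_def)
  show thesis
  proof (rule that[of \<Phi>])
    have sub: "ball 0 ?r \<subseteq> ball 0 \<delta>" using radius_le by auto
    have cb: "continuous_on (ball 0 ?r) b"
      using continuous_exit_point by (simp add: b_def)
    have cf: "continuous_on (ball 0 ?r) f" using continuous_on_subset[OF continuous_f sub] .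
    have cpb: "continuous_on (ball 0 ?r) (\<lambda>x. p (b x))"
      by (rule continuous_on_compose2[OF continuous_p cb]) auto
    have cR: "continuous_on (ball 0 ?r) R" and cZ: "continuous_on (ball 0 ?r) Z"
      unfolding R_def Z_def z_def by (intro continuous_intros cb cf cpb)+
    have cz: "continuous_on (ball 0 ?r) z" unfolding z_def by (intro continuous_intros continuous_p)
    show "continuous_on (ball 0 ?r) \<Phi>"
      unfolding \<Phi>_def using R_zero Z_zero
      by (intro continuous_on_add continuous_scaleR_sgn cR cZ cz continuous_p) auto
    show "\<Phi> 0 = 0" by (simp add: \<Phi>_def z_def)
    fix x :: 'a assume "x \<in> ball 0 ?r"
    then have x: "norm x < ?r" by simp
    have "norm (p (\<Phi> x)) = R x" "norm (\<Phi> x - p (\<Phi> x)) = Z x"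
      unfolding p_\<Phi>(2) unfolding p_\<Phi>(1) using R_zero[OF x] Z_zero[OF x] RZ_nonneg[of x] by (auto simp: norm_sgn)
    then show "f x = (norm (\<Phi> x - p (\<Phi> x)))\<^sup>2 - (norm (p (\<Phi> x)))\<^sup>2"
      using f_RZ by simp
  next
    show "inj_on \<Phi> (ball 0 ?r)"
    proof (rule inj_onI)
      fix x y :: 'a assume "x \<in> ball 0 ?r" "y \<in> ball 0 ?r" and eq: "\<Phi> x = \<Phi> y"
      then have x: "norm x < ?r" and y: "norm y < ?r" by auto
      have "R x *\<^sub>R sgn (p x) = R y *\<^sub>R sgn (p y)" using eq p_\<Phi>(1) by metis
      then have R: "R x = R y" "R x \<noteq> 0 \<Longrightarrow> sgn (p x) = sgn (p y)"
        using scaleR_sgn_eqD[of "R x" "p x" "R y" "p y"] R_zero x y RZ_nonneg by auto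
      have "Z x *\<^sub>R sgn (z x) = Z y *\<^sub>R sgn (z y)" using eq p_\<Phi>(2) by metis
      then have Z: "Z x = Z y" "Z x \<noteq> 0 \<Longrightarrow> sgn (z x) = sgn (z y)"
        using scaleR_sgn_eqD[of "Z x" "z x" "Z y" "z y"] Z_zero x y RZ_nonneg by auto
      have f: "f x = f y" using f_RZ R Z by simp
      have p_iff: "p x = 0 \<longleftrightarrow> p y = 0"
        using R_zero[OF x] R_zero[OF y] R_pos[OF x] R_pos[OF y] R(1) by (metis less_irrefl)
      have same_b: "b x = b y"
        if z: "z (b x) = z (b y)" and px: "p x \<noteq> 0" and fb: "f (b x) = f (b y)"
      proof -
        have sgn: "sgn (p x) = sgn (p y)" using R(2) R_pos[OF x px] by simp
        have py: "p y \<noteq> 0" using px p_iff by simp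
        have b: "b w = z (b w) + norm (p (b w)) *\<^sub>R sgn (p w)" if "norm w < ?r" "p w \<noteq> 0" for w
        proof -
          have "p (b w) = norm (p (b w)) *\<^sub>R sgn (p w)"
            using exit_nonzero(2)[OF that] that by (simp add: zb sgn_div_norm)
          moreover have "b w = z (b w) + p (b w)" by (simp add: z_def)
          ultimately show ?thesis by simp
        qed
        show ?thesis
        proof (rule line_eq[of "sgn (p x)" "z (b x)" "norm (p (b x))" "norm (p (b y))"])
          show "b x = z (b x) + norm (p (b x)) *\<^sub>R (sgn (p x) - M *\<^sub>R v)"
            using b[OF x px] v0 by simp
          show "b y = z (b x) + norm (p (b y)) *\<^sub>R (sgn (p x) - M *\<^sub>R v)"
            using b[OF y py] v0 z sgn by simp
          show "p (z (b x)) = 0" by (simp add: z_def)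
        qed (use px fb exit_time(2)[OF x] norm_exit_point[OF x] norm_exit_point[OF y]
              in \<open>auto simp: proj_sgn norm_sgn b_def\<close>)
      qed
      show "x = y"
      proof (cases "f x \<le> 0")
        case True
        then have b: "b x = x" "b y = y" using b_nonpos x y f by auto
        have "z w = Z w *\<^sub>R sgn (z w)" if "f w \<le> 0" "b w = w" for w
          using that by (simp add: Z_def norm_scaleR_sgn)
        then have z: "z x = z y" using True f b \<open>Z x *\<^sub>R sgn (z x) = Z y *\<^sub>R sgn (z y)\<close> by metis
        show ?thesis
        proof (cases "p x = 0")
          case True
          then show ?thesis using p_iff z by (simp add: z_def)
        next
          case False
          then show ?thesis using same_b b z f by simp
        qed
      next
        case False
        then have zx: "z x \<noteq> 0" "z y \<noteq> 0" using f_nonpos[OF x] f_nonpos[OF y] f by auto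
        have "Z x \<noteq> 0" using False by (simp add: Z_def add_nonneg_pos less_imp_neq[symmetric])
        then have sgn_z: "sgn (z x) = sgn (z y)" by (rule Z(2))
        show ?thesis
        proof (cases "p x = 0")
          \<comment> \<open>Rays in the kernel of \<open>p\<close> all exit at the origin. Their
            direction is still recorded by \<open>sgn (z x)\<close>, so both points lie on one ray
            and their common value separates nothing but equals.\<close>
          case True
          then have "z x = x" "z y = y" using p_iff by (auto simp: z_def)
          then have "sgn x = sgn y" "x \<noteq> 0" "y \<noteq> 0" using sgn_z zx by auto
          then have "flow (norm y / norm x) x = y"
            by (simp add: flow_eq sgn_div_norm field_simps)
              (metis scaleR_scaleR divide_inverse norm_eq_zero right_inverse scaleR_one)
          then show ?thesis
            using same_flow_line_eq[of x "norm y / norm x"] x y f False \<open>x \<noteq> 0\<close> \<open>y \<noteq> 0\<close> by simp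
        next
          case px: False
          have fb: "f (b x) = 0" "f (b y) = 0" using f_exit_point x y f False by (auto simp: b_def)
          have nz: "norm (z (b x)) = norm (z (b y))" using R(1) False f by (simp add: R_def)
          \<comment> \<open>The vector \<open>z (b w)\<close> is recovered from its length, which is
            \<open>R\<close>, and its direction, which is that of \<open>z w\<close>.\<close>
          have "z (b w) = norm (z (b w)) *\<^sub>R sgn (z w)" if "norm w < ?r" "p w \<noteq> 0" for w
            using exit_nonzero(2)[OF that] by (simp add: zb norm_scaleR_sgn flip: scaleR_scaleR)
          then have "z (b x) = z (b y)" using nz sgn_z px p_iff x y by metis
          then have "b x = b y" using same_b px fb by simp
          then show ?thesis using exit_point_eqD[OF x y] exit_nonzero(1)[OF x px] f False
            by (simp add: b_def)
        qed
      qed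
    qed
  qed
qed

text \<open>A point with \<open>f \<le> 0\<close> is determined by its value and by the half-line with direction \<open>e - M v\<close>
  through it. The starting point \<open>\<xi>\<close> of that half-line is recovered from its component orthogonal to \<open>v\<close>
  and the gap between \<open>f\<close> and the value at \<open>\<xi>\<close> of \<open>f1\<close>, the minimum of those \<open>g i\<close> that increase
  along \<open>v\<close>. This gap vanishes exactly when the point lies in the kernel of \<^term>\<open>p\<close>, so scaling \<open>e\<close> by it
  is continuous there. Points with \<open>f > 0\<close> are labelled by their exit point and their value.\<close>

lemma regular_coordinate:
  assumes S1_ne: "S0 \<noteq> I" and v1: "norm v = 1" and \<eta>: "0 < \<eta>"
  obtains r and \<Phi> :: "'a \<Rightarrow> 'a" where "0 < r" "r \<le> \<delta>"
    "continuous_on (ball 0 r) \<Phi>" "inj_on \<Phi> (ball 0 r)" "\<And>x. x \<in> ball 0 r \<Longrightarrow> \<Phi> x \<bullet> v = f x"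
proof -
  \<comment> \<open>The factor 1 + \<eta> allows for the growth of norms along the flow, and 2 + M
    for that under \<open>\<xi>\<close>.\<close>
  define r where "r = \<delta> / ((1 + \<eta>) * (2 + M))"
  define f1 where "f1 = (\<lambda>x. Min ((\<lambda>i. g i x) ` (I - S0)))"
  \<comment> \<open>Solves y = \<xi> + |p y| (sgn (p y) - M v) for \<xi>; see
    \<open>line\<close>.\<close>
  define \<xi> where "\<xi> = (\<lambda>y. y - p y + (M * norm (p y)) *\<^sub>R v)"
  define \<zeta> where "\<zeta> = (\<lambda>y. \<xi> y - (\<xi> y \<bullet> v) *\<^sub>R v)"
  define R where "R = (\<lambda>y. f1 (\<xi> y) - f y)"
  define b where "b = exit_point"
  define \<Phi> where "\<Phi> = (\<lambda>x. R (b x) *\<^sub>R sgn (p (b x)) + \<zeta> (b x) + f x *\<^sub>R v)"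
  have r: "0 < r" "r \<le> \<delta> / (1 + \<eta>)" using pos unfolding r_def
    by (intro divide_pos_pos mult_pos_pos divide_left_mono; simp add: mult_left_le)+
  have fin1: "finite (I - S0)" "I - S0 \<noteq> {}" using S1_ne fin by auto
  have vv: "v \<bullet> v = 1" using v1 by (simp add: norm_eq_1)
  have f1_active: "\<exists>i\<in>I - S0. f1 x = g i x" for x
  proof -
    have "f1 x \<in> (\<lambda>i. g i x) ` (I - S0)" unfolding f1_def using fin1 by (intro Min_in) auto
    then show ?thesis by auto
  qed
  have f1_le: "f1 x \<le> g i x" if "i \<in> I - S0" for i x
    unfolding f1_def using that fin1 by auto
  have f_le_f1: "f x \<le> f1 x" for x using f1_active[of x] f_le by auto
  have f1_0: "f1 0 = 0" using f1_active[of 0] g0 by auto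
  have Gv: "0 < G i x \<bullet> v" if "i \<in> I - S0" "norm x < \<delta>" for i x
    using le_less_trans[OF norm_ge_zero S1[OF that]] pos by (simp add: zero_less_mult_iff)
  have f1_less: "f1 (x + s *\<^sub>R v) < f1 (x + t *\<^sub>R v)"
    if st: "s < t" and ball: "norm (x + s *\<^sub>R v) < \<delta>" "norm (x + t *\<^sub>R v) < \<delta>" for x s t
  proof -
    obtain i where i: "i \<in> I - S0" "f1 (x + t *\<^sub>R v) = g i (x + t *\<^sub>R v)" using f1_active by blast
    have "g i (x + s *\<^sub>R v) < g i (x + t *\<^sub>R v)"
    proof (rule DERIV_pos_imp_increasing[OF st])
      fix q assume q: "s \<le> q" "q \<le> t"
      define w where "w = (q - s) / (t - s)"
      have w: "0 \<le> w" "w \<le> 1" using q st by (auto simp: w_def)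
      have "w * (t - s) = q - s" using st by (simp add: w_def)
      then have "q = (1 - w) * s + w * t" by (simp add: algebra_simps)
      moreover have "x + ((1 - w) * s + w * t) *\<^sub>R v
          = (1 - w) *\<^sub>R (x + s *\<^sub>R v) + w *\<^sub>R (x + t *\<^sub>R v)"
        by (simp add: algebra_simps)
      ultimately have "x + q *\<^sub>R v \<in> ball 0 \<delta>"
        using convexD[OF convex_ball, of "x + s *\<^sub>R v" 0 \<delta> "x + t *\<^sub>R v" "1 - w" w] w ball by simp
      then have nq: "norm (x + q *\<^sub>R v) < \<delta>" by simp
      have "((\<lambda>q. x + q *\<^sub>R v) has_derivative (\<lambda>h. h *\<^sub>R v)) (at q)"
        by (auto intro!: derivative_eq_intros)
      from has_derivative_compose[OF this deriv[OF _ nq, of i]] i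
      have "((\<lambda>q. g i (x + q *\<^sub>R v)) has_real_derivative G i (x + q *\<^sub>R v) \<bullet> v) (at q)"
        by (auto intro!: has_derivative_imp_has_field_derivative)
      then show "\<exists>y. ((\<lambda>q. g i (x + q *\<^sub>R v)) has_real_derivative y) (at q) \<and> 0 < y"
        using Gv[OF i(1) nq] by blast
    qed
    then show ?thesis using f1_le[OF i(1), of "x + s *\<^sub>R v"] i(2) by simp
  qed
  have f1_inj: "s = t" if "f1 (x + s *\<^sub>R v) = f1 (x + t *\<^sub>R v)"
    "norm (x + s *\<^sub>R v) < \<delta>" "norm (x + t *\<^sub>R v) < \<delta>" for x s t
    using f1_less[of s t x] f1_less[of t s x] that by (cases s t rule: linorder_cases) auto
  have cont_f1: "continuous_on (ball 0 \<delta>) f1"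
    unfolding f1_def by (intro continuous_on_Min_image fin1 continuous_g) auto
  have norm_\<xi>: "norm (\<xi> y) \<le> (2 + M) * norm y" for y
  proof -
    have "norm (\<xi> y) \<le> norm y + norm (p y) + M * norm (p y)"
      unfolding \<xi>_def using pos v1
      by (intro order_trans[OF norm_triangle_ineq] add_mono norm_triangle_ineq4) (simp add: abs_mult)
    also have "\<dots> \<le> norm y + norm y + M * norm y"
      using norm_p[of y] pos by (intro add_mono mult_left_mono) auto
    finally show ?thesis by (simp add: algebra_simps)
  qed
  have b: "norm (b x) < \<delta>" "norm (\<xi> (b x)) < \<delta>" "f (b x) \<le> 0" if x: "norm x < r" for x
  proof -
    have x': "norm x < \<delta> / (1 + \<eta>)" using x r by simp
    show "norm (b x) < \<delta>" "f (b x) \<le> 0" using norm_exit_point[OF x'] exit_time(2)[OF x'] by (auto simp: b_def)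
    have "norm (\<xi> (b x)) \<le> (2 + M) * ((1 + \<eta>) * norm x)"
      using norm_\<xi>[of "b x"] norm_exit_point(1)[OF x'] pos
      by (auto simp: b_def intro: order_trans[OF _ mult_left_mono])
    also have "\<dots> < \<delta>"
    proof -
      have "(1 + \<eta>) * (2 + M) * norm x < (1 + \<eta>) * (2 + M) * r"
        using x pos by (intro mult_strict_left_mono mult_pos_pos) auto
      also have "\<dots> = \<delta>" using pos by (simp add: r_def)
      finally show ?thesis by (simp add: mult_ac)
    qed
    finally show "norm (\<xi> (b x)) < \<delta>" .
  qed
  have p_\<xi>: "p (\<xi> y) = 0" for y by (simp add: \<xi>_def)
  have line: "y = \<xi> y + norm (p y) *\<^sub>R (sgn (p y) - M *\<^sub>R v)" for y
    by (cases "p y = 0") (simp_all add: \<xi>_def scaleR_diff_right sgn_div_norm mult.commute)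
  \<comment> \<open>Functions in \<open>S0\<close> have no linear part on the kernel of
    \<open>p\<close>, so they are positive at a nonzero such point and cannot be active where
    \<open>f\<close> is nonpositive.\<close>
  have f_f1: "f1 y = f y" if y: "norm y < \<delta>" "p y = 0" "f y \<le> 0" for y
  proof (cases "y = 0")
    case True
    then show ?thesis using f1_0 by simp
  next
    case False
    obtain i where i: "i \<in> I" "f y = g i y" by (rule f_active)
    have "i \<notin> S0"
    proof
      assume "i \<in> S0"
      then have "G i 0 \<bullet> y = 0" using S0 y(2) inner_p_zero by blast
      moreover have "0 < c * (norm y)\<^sup>2" using False pos by simp
      ultimately show False using lower[OF i(1) y(1)] i y by simp
    qed
    then show ?thesis using f1_le[of i y] f_le_f1[of y] i by auto
  qed
  have R_zero: "R y = 0" if "norm y < \<delta>" "f y \<le> 0" "p y = 0" for y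
    using f_f1[OF that(1,3,2)] that by (simp add: R_def \<xi>_def)
  have R_pos: "0 < R y" if y: "norm y < \<delta>" "norm (\<xi> y) < \<delta>" "f y \<le> 0" "p y \<noteq> 0" for y
  proof (cases "f (\<xi> y) \<le> 0")
    case True
    have "f (\<xi> y + norm (p y) *\<^sub>R (sgn (p y) - M *\<^sub>R v)) < f (\<xi> y + 0 *\<^sub>R (sgn (p y) - M *\<^sub>R v))"
      by (rule f_decreasing) (use y True line[of y] p_\<xi> in \<open>auto simp: proj_sgn norm_sgn\<close>)
    then have "f y < f (\<xi> y)" using line[of y] by simp
    then show ?thesis using f_le_f1[of "\<xi> y"] by (simp add: R_def)
  next
    case False
    then show ?thesis using f_le_f1[of "\<xi> y"] y by (simp add: R_def)
  qed
  have inner_sgn_v: "sgn (p y) \<bullet> v = 0" for y using inner_p_zero[OF proj_sgn(1)] by simp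
  have inner_\<zeta>_v: "\<zeta> y \<bullet> v = 0" for y by (simp add: \<zeta>_def inner_diff_left vv)
  have p_\<zeta>: "p (\<zeta> y) = 0" for y by (simp add: \<zeta>_def p_\<xi>)
  have \<Phi>_v: "\<Phi> x \<bullet> v = f x" for x
    by (simp add: \<Phi>_def inner_add_left inner_sgn_v inner_\<zeta>_v vv)
  have p_\<Phi>: "p (\<Phi> x) = R (b x) *\<^sub>R sgn (p (b x))" for x
    using proj_sgn by (simp add: \<Phi>_def p_\<zeta>)
  \<comment> \<open>The purpose of the bending: off the \<open>v\<close>-axis, s ln s pushes the
    flow line against \<open>v\<close> hard enough for some \<open>g i\<close> outside
    \<open>S0\<close> to become nonpositive at a positive time.\<close>
  have exit_nonzero: "b x \<noteq> 0" if x: "norm x < r" and u: "x - (x \<bullet> v) *\<^sub>R v \<noteq> 0" for x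
  proof -
    have x': "norm x < \<delta> / (1 + \<eta>)" using x r by simp
    let ?u = "norm (x - (x \<bullet> v) *\<^sub>R v)"
    obtain i where i: "i \<in> I - S0" using fin1 by blast
    define \<alpha> where "\<alpha> = G i 0 \<bullet> v"
    have \<alpha>: "0 < \<alpha>" using Gv[OF i, of 0] pos by (simp add: \<alpha>_def)
    \<comment> \<open>\<open>s * K\<close> bounds the quadratic term of \<open>g i\<close> on the
      flow line, by way of |s ln s| \<le> 2 sqrt s. With s = exp (-N) the whole upper bound is s
      times a bracket, and \<open>N\<close> is chosen to make that bracket nonpositive.\<close>
    define K where "K = C * (norm x + 2 * \<eta> * ?u)\<^sup>2"
    define N where "N = max 0 ((G i 0 \<bullet> x + K) / (\<eta> * \<alpha> * ?u))"
    define s where "s = exp (- N)"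
    have s: "0 < s" "s \<le> 1" "ln s = - N" by (auto simp: s_def N_def)
    have "norm (flow s x) \<le> s * norm x + \<eta> * \<bar>s * ln s\<bar> * ?u"
      unfolding flow_def using s pos v1
      by (intro order_trans[OF norm_triangle_ineq]) (simp add: abs_mult)
    also have "\<dots> \<le> sqrt s * norm x + \<eta> * (2 * sqrt s) * ?u"
    proof (intro add_mono mult_right_mono mult_left_mono)
      have "s = sqrt s * sqrt s" using s by simp
      also have "\<dots> \<le> sqrt s * 1" using s by (intro mult_left_mono) auto
      finally show "s \<le> sqrt s" by simp
      show "\<bar>s * ln s\<bar> \<le> 2 * sqrt s" by (rule mult_ln_bounds(2)) (use s in auto)
    qed (use pos in auto)
    also have "\<dots> = sqrt s * (norm x + 2 * \<eta> * ?u)" by (simp add: algebra_simps)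
    finally have "(norm (flow s x))\<^sup>2 \<le> (sqrt s * (norm x + 2 * \<eta> * ?u))\<^sup>2"
      by (intro power_mono) auto
    also have "\<dots> = s * (norm x + 2 * \<eta> * ?u)\<^sup>2" using s by (simp add: power_mult_distrib)
    finally have "C * (norm (flow s x))\<^sup>2 \<le> C * (s * (norm x + 2 * \<eta> * ?u)\<^sup>2)"
      using pos by (intro mult_left_mono) auto
    then have 1: "C * (norm (flow s x))\<^sup>2 \<le> s * K" by (simp add: K_def mult_ac)
    have "f (flow s x) \<le> G i 0 \<bullet> flow s x + C * (norm (flow s x))\<^sup>2"
      using f_le[of i "flow s x"] upper[of i "flow s x"] i flow_in_ball[OF x', of s] s by auto
    also have "\<dots> \<le> G i 0 \<bullet> flow s x + s * K" using 1 by simp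
    also have "\<dots> = s * (G i 0 \<bullet> x + K - N * (\<eta> * \<alpha> * ?u))"
      by (simp add: flow_def inner_add_right s(3) \<alpha>_def algebra_simps)
    also have "\<dots> \<le> s * 0"
    proof (intro mult_left_mono)
      have "0 < \<eta> * \<alpha> * ?u" using \<eta> \<alpha> u by simp
      moreover have "(G i 0 \<bullet> x + K) / (\<eta> * \<alpha> * ?u) \<le> N" by (simp add: N_def)
      ultimately show "G i 0 \<bullet> x + K - N * (\<eta> * \<alpha> * ?u) \<le> 0" by (simp add: pos_divide_le_eq)
    qed (use s in auto)
    finally have "0 < exit_time x" using exit_time_pos[OF x', of s] s by simp
    moreover have "x \<noteq> 0" using u by auto
    ultimately show ?thesis using flow_nonzero by (simp add: b_def exit_point_def)
  qed
  have axis_pos: "0 < a" if a: "norm (a *\<^sub>R v) < r" "0 < f (a *\<^sub>R v)" for a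
  proof (rule ccontr)
    assume "\<not> 0 < a"
    then have "a = 0 \<or> a < 0" by auto
    then have "f1 (0 + a *\<^sub>R v) \<le> f1 (0 + 0 *\<^sub>R v)"
      using f1_less[of a 0 0] a r radius_le pos by auto
    then show False using f1_0 f_le_f1[of "a *\<^sub>R v"] a by simp
  qed
  show thesis
  proof (rule that[of r \<Phi>])
    show "0 < r" "r \<le> \<delta>" using r radius_le by auto
    show "\<Phi> x \<bullet> v = f x" for x by (rule \<Phi>_v)
    have sub: "ball 0 r \<subseteq> ball 0 (\<delta> / (1 + \<eta>))" using r by auto
    have cb: "continuous_on (ball 0 r) b"
      using continuous_on_subset[OF continuous_exit_point sub] by (simp add: b_def)
    have cf: "continuous_on (ball 0 r) f"
      by (rule continuous_on_subset[OF continuous_f]) (use r radius_le in auto)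
    have cpb: "continuous_on (ball 0 r) (\<lambda>x. p (b x))"
      by (rule continuous_on_compose2[OF continuous_p cb]) auto
    have c\<xi>: "continuous_on (ball 0 r) (\<lambda>x. \<xi> (b x))"
      unfolding \<xi>_def by (intro continuous_intros cb cpb)
    have cfb: "continuous_on (ball 0 r) (\<lambda>x. f (b x))"
      by (rule continuous_on_compose2[OF continuous_f cb]) (use b in auto)
    have "continuous_on (ball 0 r) (\<lambda>x. f1 (\<xi> (b x)))"
      by (rule continuous_on_compose2[OF cont_f1 c\<xi>]) (use b in auto)
    then have cR: "continuous_on (ball 0 r) (\<lambda>x. R (b x))"
      unfolding R_def by (intro continuous_on_diff cfb)
    have c\<zeta>: "continuous_on (ball 0 r) (\<lambda>x. \<zeta> (b x))"
      unfolding \<zeta>_def by (intro continuous_intros c\<xi>)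
    have "continuous_on (ball 0 r) (\<lambda>x. R (b x) *\<^sub>R sgn (p (b x)))"
      by (rule continuous_scaleR_sgn[OF cR cpb]) (use R_zero b in auto)
    then show "continuous_on (ball 0 r) \<Phi>"
      unfolding \<Phi>_def by (rule continuous_on_add[OF continuous_on_add[OF _ c\<zeta>]
            continuous_on_scaleR[OF cf continuous_on_const]])
    show "inj_on \<Phi> (ball 0 r)"
    proof (rule inj_onI)
      fix x y :: 'a assume "x \<in> ball 0 r" "y \<in> ball 0 r" and eq: "\<Phi> x = \<Phi> y"
      then have x: "norm x < r" and y: "norm y < r" by auto
      then have x': "norm x < \<delta> / (1 + \<eta>)" and y': "norm y < \<delta> / (1 + \<eta>)" using r by auto
      have f: "f x = f y" using \<Phi>_v eq by metis
      have Rs: "R (b x) *\<^sub>R sgn (p (b x)) = R (b y) *\<^sub>R sgn (p (b y))" using p_\<Phi> eq by metis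
      then have \<zeta>: "\<zeta> (b x) = \<zeta> (b y)" using eq f by (simp add: \<Phi>_def)
      have R_cases: "p (b w) = 0 \<and> R (b w) = 0 \<or> p (b w) \<noteq> 0 \<and> 0 < R (b w)" if "norm w < r" for w
        using R_zero[of "b w"] R_pos[of "b w"] b[OF that] by auto
      have R: "R (b x) = R (b y)" "R (b x) \<noteq> 0 \<Longrightarrow> sgn (p (b x)) = sgn (p (b y))"
        using scaleR_sgn_eqD[OF Rs] R_cases[OF x] R_cases[OF y] by auto
      \<comment> \<open>Each side is the minimum of 0 and the common value of
        \<open>f\<close>.\<close>
      have fb: "f (b x) = f (b y)"
        using exit_point_of_nonpos x' y' f_exit_point f by (cases "f x \<le> 0") (auto simp: b_def)
      have \<xi>_\<zeta>: "\<xi> w = \<zeta> w + (\<xi> w \<bullet> v) *\<^sub>R v" for w by (simp add: \<zeta>_def)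
      have "f1 (\<xi> (b x)) = f1 (\<xi> (b y))" using R(1) fb by (simp add: R_def)
      \<comment> \<open>Since \<open>f1\<close> increases strictly along \<open>v\<close>, its value
        fixes the one component of \<open>\<xi>\<close> that \<open>\<zeta>\<close> forgets.\<close>
      then have "\<xi> (b x) \<bullet> v = \<xi> (b y) \<bullet> v"
        using f1_inj[of "\<zeta> (b x)" "\<xi> (b x) \<bullet> v" "\<xi> (b y) \<bullet> v"] b(2)[OF x] b(2)[OF y]
        by (metis \<xi>_\<zeta> \<zeta>)
      then have \<xi>: "\<xi> (b x) = \<xi> (b y)" using \<xi>_\<zeta> \<zeta> by metis
      have bb: "b x = b y"
      proof (cases "p (b x) = 0")
        case True
        then have "p (b y) = 0" using R_cases[OF x] R_cases[OF y] R(1) by auto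
        then show ?thesis using True \<xi> by (simp add: \<xi>_def)
      next
        case False
        then have sgn: "sgn (p (b y)) = sgn (p (b x))" using R_cases[OF x] R(2) by auto
        show ?thesis
        proof (rule line_eq[of "sgn (p (b x))" "\<xi> (b x)" "norm (p (b x))" "norm (p (b y))"])
          show "b x = \<xi> (b x) + norm (p (b x)) *\<^sub>R (sgn (p (b x)) - M *\<^sub>R v)" by (rule line)
          show "b y = \<xi> (b x) + norm (p (b y)) *\<^sub>R (sgn (p (b x)) - M *\<^sub>R v)"
            using line[of "b y"] \<xi> sgn by simp
        qed (use False fb b x y p_\<xi> in \<open>auto simp: proj_sgn norm_sgn\<close>)
      qed
      show "x = y"
      proof (cases "f x \<le> 0")
        case True
        then show ?thesis using bb exit_point_of_nonpos x' y' f by (simp add: b_def)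
      next
        case pos_f: False
        show ?thesis
        proof (cases "b x = 0")
          case False
          then show ?thesis using exit_point_eqD[OF x' y'] bb f pos_f by (simp add: b_def)
        next
          case True
          \<comment> \<open>Only the \<open>v\<close>-axis flows into the origin without meeting {f
            \<le> 0}, and \<open>f\<close> is positive only on its positive half. On the axis the
            flow is plain scaling.\<close>
          have ax: "x = (x \<bullet> v) *\<^sub>R v" and ay: "y = (y \<bullet> v) *\<^sub>R v"
            using exit_nonzero[OF x] exit_nonzero[OF y] True bb by auto
          have 0: "0 < x \<bullet> v" "0 < y \<bullet> v"
            using axis_pos[of "x \<bullet> v"] axis_pos[of "y \<bullet> v"] ax ay x y pos_f f by auto
          have "flow (y \<bullet> v / (x \<bullet> v)) x = (y \<bullet> v / (x \<bullet> v)) *\<^sub>R x" using ax by (simp add: flow_def)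
          also have "\<dots> = (y \<bullet> v / (x \<bullet> v)) *\<^sub>R ((x \<bullet> v) *\<^sub>R v)" using ax by simp
          also have "\<dots> = y" using 0 ay by simp
          finally have fl: "flow (y \<bullet> v / (x \<bullet> v)) x = y" .
          have "x \<noteq> 0" using 0 by auto
          then show ?thesis
            using same_flow_line_eq[of x "y \<bullet> v / (x \<bullet> v)"] fl 0 x' y' f pos_f by simp
        qed
      qed
    qed
  qed
qed

end

section \<open>Second-order data of convex functions\<close>

definition grad :: "(real ^ 'n \<Rightarrow> real) \<Rightarrow> real ^ 'n \<Rightarrow> real ^ 'n" where
  "grad h x = (\<chi> i. partial_deriv i h x)"

lemma has_derivative_grad:
  fixes h :: "real ^ 'n \<Rightarrow> real"
  assumes "h differentiable (at x)"
  shows "(h has_derivative (\<lambda>d. grad h x \<bullet> d)) (at x)"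
proof -
  have D: "(h has_derivative frechet_derivative h (at x)) (at x)"
    using assms by (simp add: frechet_derivative_works)
  then have lin: "linear (frechet_derivative h (at x))" by (rule has_derivative_linear)
  have "frechet_derivative h (at x) d = grad h x \<bullet> d" for d
  proof -
    have "frechet_derivative h (at x) d = frechet_derivative h (at x) (\<Sum>i\<in>UNIV. d $ i *\<^sub>R axis i 1)"
      using basis_expansion[of d] by (simp add: scalar_mult_eq_scaleR)
    also have "\<dots> = (\<Sum>i\<in>UNIV. d $ i * partial_deriv i h x)"
      by (simp add: linear_sum[OF lin] linear_scale[OF lin] partial_deriv_def)
    finally show ?thesis by (simp add: grad_def inner_vec_def mult.commute)
  qed
  then have "frechet_derivative h (at x) = (\<lambda>d. grad h x \<bullet> d)" by auto
  then show ?thesis using D by simp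
qed

text \<open>The quadratic form attains a positive minimum on the compact unit sphere, and
  homogeneity does the rest.\<close>

lemma positive_definite_lower_bound:
  fixes A :: "real ^ 'n ^ 'n"
  assumes "positive_definite A"
  obtains m where "0 < m" "\<And>d. m * (norm d)\<^sup>2 \<le> d \<bullet> (A *v d)"
proof -
  have "continuous_on (sphere 0 1) (\<lambda>d. d \<bullet> (A *v d))"
    by (intro continuous_on_inner continuous_on_id matrix_vector_mult_linear_continuous_on)
  moreover have "sphere (0 :: real ^ 'n) 1 \<noteq> {}" by simp
  ultimately obtain d0 where d0: "d0 \<in> sphere 0 1"
      "\<And>d. d \<in> sphere 0 1 \<Longrightarrow> d0 \<bullet> (A *v d0) \<le> d \<bullet> (A *v d)"
    using continuous_attains_inf[OF compact_sphere] by blast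
  show thesis
  proof (rule that)
    have "d0 \<noteq> 0" using d0(1) by auto
    then show "0 < d0 \<bullet> (A *v d0)" using assms by (simp add: positive_definite_def)
    fix d :: "real ^ 'n"
    show "d0 \<bullet> (A *v d0) * (norm d)\<^sup>2 \<le> d \<bullet> (A *v d)"
    proof (cases "d = 0")
      case False
      then have "d0 \<bullet> (A *v d0) \<le> sgn d \<bullet> (A *v sgn d)" by (intro d0) (simp add: norm_sgn)
      also have "\<dots> = (d \<bullet> (A *v d)) / (norm d)\<^sup>2"
        by (simp add: sgn_div_norm matrix_vector_mult_scaleR power2_eq_square divide_inverse)
      finally show ?thesis using False by (simp add: pos_le_divide_eq)
    qed simp
  qed
qed

lemma has_derivative_grad_hessian:
  fixes h :: "real ^ 'n \<Rightarrow> real"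
  assumes "\<And>j. partial_deriv j h differentiable (at p)"
  shows "(grad h has_derivative (\<lambda>d. \<chi> j. grad (partial_deriv j h) p \<bullet> d)) (at p)"
proof -
  have "((\<lambda>x. grad h x \<bullet> b) has_derivative (\<lambda>d. (\<chi> j. grad (partial_deriv j h) p \<bullet> d) \<bullet> b)) (at p)"
    if b: "b \<in> Basis" for b
  proof -
    obtain j where "b = axis j 1" using b by (auto simp: Basis_vec_def)
    then show ?thesis
      using has_derivative_grad[OF assms[of j]] by (simp add: inner_axis grad_def)
  qed
  then show ?thesis using has_derivative_componentwise_within by blast
qed

lemma second_order_expansion:
  fixes h :: "real ^ 'n \<Rightarrow> real"
  assumes S: "open S" "p \<in> S" and diff: "\<And>x. x \<in> S \<Longrightarrow> h differentiable (at x)"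
    and D: "(grad h has_derivative A) (at p)" and e: "0 < e"
  shows "\<forall>\<^sub>F x in nhds 0. p + x \<in> S \<and> norm (grad h (p + x) - grad h p - A x) \<le> e * norm x \<and>
    \<bar>h (p + x) - h p - grad h p \<bullet> x - A x \<bullet> x / 2\<bar> \<le> e * (norm x)\<^sup>2"
proof -
  obtain d where d: "0 < d" "\<And>y. norm (y - p) < d \<Longrightarrow>
      norm (grad h y - grad h p - A (y - p)) \<le> e * norm (y - p)"
    using D e unfolding has_derivative_at_alt by blast
  obtain d' where d': "0 < d'" "ball p d' \<subseteq> S" using S open_contains_ball by metis
  have linA: "linear A" using D by (rule has_derivative_linear)
  have main: "p + x \<in> S \<and> norm (grad h (p + x) - grad h p - A x) \<le> e * norm x \<and>
    \<bar>h (p + x) - h p - grad h p \<bullet> x - A x \<bullet> x / 2\<bar> \<le> e * (norm x)\<^sup>2" if x: "norm x < min d d'" for x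
  proof -
    have G: "norm (grad h (p + t *\<^sub>R x) - grad h p - A (t *\<^sub>R x)) \<le> e * norm (t *\<^sub>R x)" "p + t *\<^sub>R x \<in> S"
      if "0 \<le> t" "t \<le> 1" for t
    proof -
      have "t * norm x \<le> 1 * norm x" using that by (intro mult_right_mono) auto
      then have "norm (t *\<^sub>R x) < d" "norm (t *\<^sub>R x) < d'" using x that by auto
      then show "norm (grad h (p + t *\<^sub>R x) - grad h p - A (t *\<^sub>R x)) \<le> e * norm (t *\<^sub>R x)" "p + t *\<^sub>R x \<in> S"
        using d(2)[of "p + t *\<^sub>R x"] d'(2) by (auto simp: dist_norm)
    qed
    \<comment> \<open>The restriction of \<open>h\<close> to the segment minus its linear term and
      quadratic model. By the mean value theorem the remainder reduces to the error of the linear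
      approximation of the gradient at one intermediate point.\<close>
    define \<psi> where "\<psi> = (\<lambda>t. h (p + t *\<^sub>R x) - t * (grad h p \<bullet> x) - t\<^sup>2 / 2 * (A x \<bullet> x))"
    define \<psi>' where "\<psi>' = (\<lambda>t. grad h (p + t *\<^sub>R x) \<bullet> x - grad h p \<bullet> x - t * (A x \<bullet> x))"
    have der: "(\<psi> has_real_derivative \<psi>' t) (at t)" if "0 \<le> t" "t \<le> 1" for t
    proof -
      have "((\<lambda>t. p + t *\<^sub>R x) has_derivative (\<lambda>k. k *\<^sub>R x)) (at t)"
        by (auto intro!: derivative_eq_intros)
      from has_derivative_compose[OF this has_derivative_grad[OF diff[OF G(2)[OF that]]]]
      have "((\<lambda>t. h (p + t *\<^sub>R x)) has_real_derivative grad h (p + t *\<^sub>R x) \<bullet> x) (at t)"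
        by (auto intro!: has_derivative_imp_has_field_derivative)
      then show ?thesis unfolding \<psi>_def \<psi>'_def by (auto intro!: derivative_eq_intros)
    qed
    have "\<exists>t. 0 < t \<and> t < 1 \<and> \<psi> 1 - \<psi> 0 = (1 - 0) * \<psi>' t"
      by (rule MVT2) (auto intro: der)
    then obtain t where t: "0 < t" "t < 1" "\<psi> 1 - \<psi> 0 = \<psi>' t" by auto
    have "\<psi>' t = (grad h (p + t *\<^sub>R x) - grad h p - A (t *\<^sub>R x)) \<bullet> x"
      by (simp add: \<psi>'_def inner_diff_left linear_scale[OF linA])
    then have "\<bar>\<psi>' t\<bar> \<le> norm (grad h (p + t *\<^sub>R x) - grad h p - A (t *\<^sub>R x)) * norm x"
      using Cauchy_Schwarz_ineq2 by metis
    also have "\<dots> \<le> (e * norm (t *\<^sub>R x)) * norm x" using G(1)[of t] t by (intro mult_right_mono) auto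
    also have "\<dots> = t * (e * (norm x)\<^sup>2)" using t by (simp add: power2_eq_square)
    also have "\<dots> \<le> 1 * (e * (norm x)\<^sup>2)" using t e by (intro mult_right_mono) auto
    finally have "\<bar>\<psi> 1 - \<psi> 0\<bar> \<le> e * (norm x)\<^sup>2" using t by simp
    then have "\<bar>h (p + x) - h p - grad h p \<bullet> x - A x \<bullet> x / 2\<bar> \<le> e * (norm x)\<^sup>2"
      by (simp add: \<psi>_def algebra_simps)
    then show ?thesis using G[of 1] by simp
  qed
  have "\<forall>\<^sub>F x in nhds 0. x \<in> ball (0 :: real ^ 'n) (min d d')"
    using d d' by (intro eventually_nhds_in_open) auto
  then show ?thesis by (rule eventually_mono) (use main in auto)
qed

text \<open>The last three conjuncts are \<open>lip\<close>, \<open>lower\<close> and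
  \<open>euler\<close> of \<open>min_germ\<close>, with \<open>p\<close> moved to the origin and its
  value subtracted.\<close>

definition strong_convexity_at ::
    "real \<Rightarrow> real \<Rightarrow> (real ^ 'n) set \<Rightarrow> (real ^ 'n \<Rightarrow> real) \<Rightarrow> real ^ 'n \<Rightarrow> real ^ 'n \<Rightarrow> bool" where
  "strong_convexity_at c C S h p x \<longleftrightarrow> p + x \<in> S \<and>
     norm (grad h (p + x) - grad h p) \<le> C * norm x \<and>
     grad h p \<bullet> x + c * (norm x)\<^sup>2 \<le> h (p + x) - h p \<and>
     h (p + x) - h p + c * (norm x)\<^sup>2 \<le> grad h (p + x) \<bullet> x"

lemma strong_convexity_at_mono:
  assumes "strong_convexity_at c C S h p x" "c' \<le> c" "C \<le> C'"
  shows "strong_convexity_at c' C' S h p x"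
proof -
  have "c' * (norm x)\<^sup>2 \<le> c * (norm x)\<^sup>2" "C * norm x \<le> C' * norm x"
    using assms by (auto intro: mult_right_mono)
  then show ?thesis using assms(1) unfolding strong_convexity_at_def by linarith
qed

lemma convex_function_differentiable:
  assumes "convex_function_on S h" "x \<in> S"
  shows "h differentiable (at x)" "partial_deriv j h differentiable (at x)"
proof -
  have "Ck_on (Suc (Suc 0)) S h" using assms by (auto simp: convex_function_on_def smooth_on_def)
  then show "h differentiable (at x)" "partial_deriv j h differentiable (at x)"
    using assms(2) by auto
qed

lemma convex_function_strong_convexity:
  fixes h :: "real ^ 'n \<Rightarrow> real"
  assumes h: "convex_function_on S h" and p: "p \<in> S"
  shows "\<exists>c>0. \<exists>C>0. \<forall>\<^sub>F x in nhds 0. strong_convexity_at c C S h p x"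
proof -
  define A where "A = (\<lambda>d. \<chi> j. grad (partial_deriv j h) p \<bullet> d)"
  have D: "(grad h has_derivative A) (at p)"
    unfolding A_def using convex_function_differentiable[OF h p] by (rule_tac has_derivative_grad_hessian)
  have S: "open S" and "positive_definite (hessian h p)"
    using h p by (auto simp: convex_function_on_def)
  then obtain m where m: "0 < m" "\<And>d. m * (norm d)\<^sup>2 \<le> d \<bullet> (hessian h p *v d)"
    using positive_definite_lower_bound by blast
  \<comment> \<open>\<open>A\<close> is given by the transpose of \<open>hessian h p\<close>; a
    matrix and its transpose define the same quadratic form.\<close>
  have "A d \<bullet> d = d \<bullet> (hessian h p *v d)" for d
  proof -
    have "A d \<bullet> d = (\<Sum>j\<in>UNIV. \<Sum>i\<in>UNIV. d $ j * (partial_deriv i (partial_deriv j h) p * d $ i))"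
      by (simp add: A_def inner_vec_def grad_def sum_distrib_left sum_distrib_right mult_ac)
    also have "\<dots> = (\<Sum>i\<in>UNIV. \<Sum>j\<in>UNIV. d $ j * (partial_deriv i (partial_deriv j h) p * d $ i))"
      by (rule sum.swap)
    also have "\<dots> = d \<bullet> (hessian h p *v d)"
      by (simp add: inner_vec_def matrix_vector_mult_def hessian_def sum_distrib_left mult_ac)
    finally show ?thesis .
  qed
  then have A: "m * (norm d)\<^sup>2 \<le> A d \<bullet> d" for d using m by simp
  obtain K where K: "0 < K" "\<And>d. norm (A d) \<le> norm d * K"
    using bounded_linear.pos_bounded[OF has_derivative_bounded_linear[OF D]] by blast
  \<comment> \<open>The inequality for the tangent at \<open>p + x\<close> spends two errors of m/8
    out of the m/2 supplied by the Hessian, which leaves exactly m/4.\<close>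
  have "\<forall>\<^sub>F x in nhds 0. strong_convexity_at (m / 4) (K + m / 8) S h p x"
  proof (rule eventually_mono[OF second_order_expansion[OF S p convex_function_differentiable(1)[OF h] D, of "m / 8"]])
    show "0 < m / 8" using m(1) by simp
    fix x
    assume "p + x \<in> S \<and> norm (grad h (p + x) - grad h p - A x) \<le> m / 8 * norm x \<and>
      \<bar>h (p + x) - h p - grad h p \<bullet> x - A x \<bullet> x / 2\<bar> \<le> m / 8 * (norm x)\<^sup>2"
    then have x: "p + x \<in> S" "norm (grad h (p + x) - grad h p - A x) \<le> m * norm x / 8"
      "\<bar>h (p + x) - h p - grad h p \<bullet> x - A x \<bullet> x / 2\<bar> \<le> m * (norm x)\<^sup>2 / 8" by auto
    have "norm (grad h (p + x) - grad h p) \<le> norm (grad h (p + x) - grad h p - A x) + norm (A x)"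
      using norm_triangle_ineq[of "grad h (p + x) - grad h p - A x" "A x"] by simp
    then have 1: "norm (grad h (p + x) - grad h p) \<le> (K + m / 8) * norm x"
      using x(2) K(2)[of x] by (simp add: algebra_simps)
    have "\<bar>(grad h (p + x) - grad h p - A x) \<bullet> x\<bar> \<le> norm (grad h (p + x) - grad h p - A x) * norm x"
      by (rule Cauchy_Schwarz_ineq2)
    also have "\<dots> \<le> (m * norm x / 8) * norm x" using x(2) by (intro mult_right_mono) auto
    finally have 2: "\<bar>grad h (p + x) \<bullet> x - grad h p \<bullet> x - A x \<bullet> x\<bar> \<le> m * (norm x)\<^sup>2 / 8"
      by (simp add: inner_diff_left power2_eq_square)
    show "strong_convexity_at (m / 4) (K + m / 8) S h p x"
      unfolding strong_convexity_at_def using x(1) 1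
      using x(3)[unfolded abs_le_iff] 2[unfolded abs_le_iff] A[of x] by (intro conjI; linarith)
  qed
  then show ?thesis using m(1) K(1) by (intro exI[of _ "m / 4"] conjI exI[of _ "K + m / 8"]) auto
qed

lemma convex_functions_strong_convexity:
  fixes h :: "'i \<Rightarrow> real ^ 'n \<Rightarrow> real"
  assumes "finite I" "\<And>i. i \<in> I \<Longrightarrow> convex_function_on S (h i)" "p \<in> S"
  shows "\<exists>c>0. \<exists>C>0. \<forall>\<^sub>F x in nhds 0. \<forall>i\<in>I. strong_convexity_at c C S (h i) p x"
  using assms
proof (induction I rule: finite_induct)
  case empty
  then show ?case by (auto intro: exI[of _ 1])
next
  case (insert i I)
  obtain c C where c: "0 < c" "0 < C" "\<forall>\<^sub>F x in nhds 0. \<forall>i\<in>I. strong_convexity_at c C S (h i) p x"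
    using insert by auto
  obtain d D where d: "0 < d" "0 < D" "\<forall>\<^sub>F x in nhds 0. strong_convexity_at d D S (h i) p x"
    using convex_function_strong_convexity insert.prems by blast
  have "\<forall>\<^sub>F x in nhds 0. \<forall>k\<in>insert i I. strong_convexity_at (min c d) (max C D) S (h k) p x"
    using c(3) d(3)
  proof eventually_elim
    case (elim x)
    then show ?case
      using strong_convexity_at_mono[of c C S _ p x "min c d" "max C D"]
        strong_convexity_at_mono[of d D S _ p x "min c d" "max C D"] by auto
  qed
  then show ?case using c d by (intro exI[of _ "min c d"] conjI exI[of _ "max C D"]) auto
qed

text \<open>Choosing \<open>v\<close> with \<open>a i \<bullet> v \<ge> 0\<close> and as many strict inequalities as possible makes \<open>0\<close> a relative
  interior point of the convex hull of the remaining \<open>a i\<close>.\<close>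

lemma maximal_ascent_direction:
  fixes a :: "'i \<Rightarrow> 'a::euclidean_space"
  assumes fin: "finite I"
  obtains v \<kappa> where "v = 0 \<or> norm v = 1" "\<forall>i\<in>I. 0 \<le> a i \<bullet> v" "0 < \<kappa>"
    "\<forall>e\<in>span (a ` {i \<in> I. a i \<bullet> v = 0}). norm e = 1 \<longrightarrow>
      (\<exists>j\<in>{i \<in> I. a i \<bullet> v = 0}. a j \<bullet> e \<le> - \<kappa>)"
proof -
  define P where "P = (\<lambda>v. \<forall>i\<in>I. 0 \<le> a i \<bullet> v)"
  define n where "n = (\<lambda>v. card {i \<in> I. 0 < a i \<bullet> v})"
  have "P 0" by (simp add: P_def)
  moreover have "\<forall>y. P y \<longrightarrow> n y < Suc (card I)"
    unfolding n_def using fin by (auto intro!: le_imp_less_Suc card_mono)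
  ultimately obtain u where u: "P u" "\<And>y. P y \<Longrightarrow> n y \<le> n u"
    using Lattices_Big.ex_has_greatest_nat[of P 0 n "Suc (card I)"] by blast
  define v where "v = sgn u"
  have v_scale: "a i \<bullet> v = a i \<bullet> u / norm u" for i by (simp add: v_def sgn_div_norm divide_inverse mult.commute)
  define S0 where "S0 = {i \<in> I. a i \<bullet> v = 0}"
  have S0_u: "a i \<bullet> u = 0" if "i \<in> S0" for i
    using that by (cases "u = 0") (auto simp: S0_def v_scale)
  have S1_u: "0 < a i \<bullet> u" if "i \<in> I" "i \<notin> S0" for i
    using that u(1) by (cases "u = 0") (auto simp: S0_def v_scale P_def less_le)
  have finS0: "finite S0" using fin by (simp add: S0_def)
  \<comment> \<open>If no slope along \<open>y\<close> were negative, one would be positive, as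
    \<open>y\<close> is not orthogonal to the span containing it. Then u + t y, for small t > 0,
    would still be admissible and have more strict inequalities than \<open>u\<close>.\<close>
  have neg: "\<exists>j\<in>S0. a j \<bullet> y < 0" if y: "y \<in> span (a ` S0)" "y \<noteq> 0" for y
  proof (rule ccontr)
    assume "\<not> ?thesis"
    then have ge: "0 \<le> a j \<bullet> y" if "j \<in> S0" for j using that by force
    have ex: "\<exists>j\<in>S0. 0 < a j \<bullet> y"
    proof (rule ccontr)
      assume "\<not> ?thesis"
      then have "a j \<bullet> y = 0" if "j \<in> S0" for j using that ge[OF that] by force
      then have "\<And>w. w \<in> a ` S0 \<Longrightarrow> orthogonal y w" by (auto simp: orthogonal_def inner_commute)
      then have "orthogonal y y" using orthogonal_to_span[OF y(1)] by blast
      then show False using y(2) by (simp add: orthogonal_def)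
    qed
    have "\<forall>i\<in>I - S0. \<forall>\<^sub>F t in at_right 0. 0 < a i \<bullet> (u + t *\<^sub>R y)"
    proof
      fix i assume i: "i \<in> I - S0"
      have "((\<lambda>t. a i \<bullet> (u + t *\<^sub>R y)) \<longlongrightarrow> a i \<bullet> (u + 0 *\<^sub>R y)) (at_right 0)"
        by (intro tendsto_intros)
      then show "\<forall>\<^sub>F t in at_right 0. 0 < a i \<bullet> (u + t *\<^sub>R y)"
        using S1_u[of i] i by (intro order_tendstoD(1)) auto
    qed
    then have "\<forall>\<^sub>F t in at_right 0. \<forall>i\<in>I - S0. 0 < a i \<bullet> (u + t *\<^sub>R y)"
      using fin by (subst eventually_ball_finite_distrib) auto
    then have "\<forall>\<^sub>F t in at_right 0. 0 < t \<and> (\<forall>i\<in>I - S0. 0 < a i \<bullet> (u + t *\<^sub>R y))"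
      using eventually_at_right_less by (rule eventually_elim2) auto
    then obtain t where t: "0 < t" "\<And>i. i \<in> I - S0 \<Longrightarrow> 0 < a i \<bullet> (u + t *\<^sub>R y)"
      using eventually_happens[of _ "at_right (0::real)"] trivial_limit_at_right_real by blast
    have S0_t: "a i \<bullet> (u + t *\<^sub>R y) = t * (a i \<bullet> y)" if "i \<in> S0" for i
      using S0_u[OF that] by (simp add: inner_add_right)
    have "P (u + t *\<^sub>R y)"
      unfolding P_def using t ge S0_t by (metis DiffI less_imp_le mult_nonneg_nonneg)
    moreover have "{i \<in> I. 0 < a i \<bullet> u} \<subset> {i \<in> I. 0 < a i \<bullet> (u + t *\<^sub>R y)}"
    proof (rule psubsetI)
      show "{i \<in> I. 0 < a i \<bullet> u} \<subseteq> {i \<in> I. 0 < a i \<bullet> (u + t *\<^sub>R y)}"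
        using t(2) S0_u by fastforce
      obtain j where "j \<in> S0" "0 < a j \<bullet> y" using ex by blast
      then have "0 < a j \<bullet> (u + t *\<^sub>R y)" "a j \<bullet> u = 0" "j \<in> I"
        using S0_t t(1) S0_u by (auto simp: S0_def)
      then show "{i \<in> I. 0 < a i \<bullet> u} \<noteq> {i \<in> I. 0 < a i \<bullet> (u + t *\<^sub>R y)}"
        by (metis (mono_tags, lifting) less_irrefl mem_Collect_eq)
    qed
    then have "n u < n (u + t *\<^sub>R y)" unfolding n_def using fin by (intro psubset_card_mono) auto
    ultimately show False using u(2) by force
  qed
  define E where "E = span (a ` S0) \<inter> sphere 0 1"
  have "\<exists>\<kappa>>0. \<forall>e\<in>E. \<exists>j\<in>S0. a j \<bullet> e \<le> - \<kappa>"
  proof (cases "E = {}")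
    case True
    then show ?thesis by (auto intro: exI[of _ 1])
  next
    case False
    then have S0_ne: "S0 \<noteq> {}" using neg by (fastforce simp: E_def)
    \<comment> \<open>The steepest descent rate in direction \<open>e\<close>; its minimum over the
      compact unit sphere of the span is the required \<kappa>.\<close>
    define \<mu> where "\<mu> = (\<lambda>e. Max ((\<lambda>j. - (a j \<bullet> e)) ` S0))"
    have cont: "continuous_on E \<mu>"
    proof -
      have "continuous_on E (\<lambda>e. Max ((\<lambda>j. b j \<bullet> e) ` T))" if "finite T" "T \<noteq> {}" for b :: "'i \<Rightarrow> 'a" and T
        using that
      proof (induction T rule: finite_ne_induct)
        case (singleton x)
        then show ?case by (auto intro!: continuous_intros)
      next
        case (insert x F)
        have "continuous_on E (\<lambda>e. max (b x \<bullet> e) (Max ((\<lambda>j. b j \<bullet> e) ` F)))"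
          using insert by (intro continuous_on_max) (auto intro!: continuous_intros)
        then show ?case using insert by simp
      qed
      from this[OF finS0 S0_ne, of "\<lambda>j. - a j"] show ?thesis by (simp add: \<mu>_def)
    qed
    have "compact E" unfolding E_def by (intro closed_Int_compact closed_span compact_sphere)
    then obtain e0 where e0: "e0 \<in> E" "\<And>e. e \<in> E \<Longrightarrow> \<mu> e0 \<le> \<mu> e"
      using continuous_attains_inf[OF _ False cont] by blast
    have attained: "\<exists>j\<in>S0. \<mu> e = - (a j \<bullet> e)" for e
    proof -
      have "\<mu> e \<in> (\<lambda>j. - (a j \<bullet> e)) ` S0" unfolding \<mu>_def using finS0 S0_ne by (intro Max_in) auto
      then show ?thesis by auto
    qed
    have "e0 \<in> span (a ` S0)" "e0 \<noteq> 0" using e0(1) by (auto simp: E_def)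
    then obtain j where j: "j \<in> S0" "a j \<bullet> e0 < 0" using neg by blast
    have "- (a j \<bullet> e0) \<le> \<mu> e0" unfolding \<mu>_def using finS0 j by (intro Max_ge) auto
    then have "0 < \<mu> e0" using j by simp
    moreover have "\<exists>j\<in>S0. a j \<bullet> e \<le> - \<mu> e0" if "e \<in> E" for e
      using attained[of e] e0(2)[OF that] by force
    ultimately show ?thesis by blast
  qed
  then obtain \<kappa> where \<kappa>: "0 < \<kappa>" "\<And>e. e \<in> E \<Longrightarrow> \<exists>j\<in>S0. a j \<bullet> e \<le> - \<kappa>" by blast
  show thesis
  proof (rule that[of v \<kappa>])
    show "v = 0 \<or> norm v = 1" by (auto simp: v_def norm_sgn)
    show "\<forall>i\<in>I. 0 \<le> a i \<bullet> v" using u(1) by (simp add: v_scale P_def)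
    show "0 < \<kappa>" by (rule \<kappa>)
    show "\<forall>e\<in>span (a ` {i \<in> I. a i \<bullet> v = 0}). norm e = 1 \<longrightarrow>
        (\<exists>j\<in>{i \<in> I. a i \<bullet> v = 0}. a j \<bullet> e \<le> - \<kappa>)"
      using \<kappa>(2) by (simp add: E_def S0_def)
  qed
qed

text \<open>Orthonormal bases of \<open>L\<close> and its orthogonal complement are joined and
  indexed by the coordinate type itself, so that coefficients form a vector of the same space and
  \<open>J\<close> marks those along \<open>L\<close>.\<close>

lemma orthonormal_basis_adapted:
  fixes L :: "(real ^ 'n) set"
  assumes "subspace L"
  obtains \<beta> :: "'n \<Rightarrow> real ^ 'n" and J where
    "\<forall>i j. \<beta> i \<bullet> \<beta> j = (if i = j then 1 else 0)" "\<forall>x. x = (\<Sum>i\<in>UNIV. (x \<bullet> \<beta> i) *\<^sub>R \<beta> i)"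
    "L = span (\<beta> ` J)"
proof -
  define L' where "L' = {y. \<forall>x\<in>L. orthogonal x y}"
  have L': "subspace L'" unfolding L'_def by (rule subspace_orthogonal_to_vectors)
  obtain B where B: "B \<subseteq> L" "pairwise orthogonal B" "\<And>x. x \<in> B \<Longrightarrow> norm x = 1"
      "independent B" "card B = dim L" "span B = L"
    using orthonormal_basis_subspace[OF assms] by metis
  obtain B' where B': "B' \<subseteq> L'" "pairwise orthogonal B'" "\<And>x. x \<in> B' \<Longrightarrow> norm x = 1"
      "independent B'" "card B' = dim L'" "span B' = L'"
    using orthonormal_basis_subspace[OF L'] by metis
  have cross: "x \<bullet> y = 0" if "x \<in> B" "y \<in> B'" for x y
    using that B(1) B'(1) by (auto simp: L'_def orthogonal_def)
  have disj: "B \<inter> B' = {}"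
  proof (rule ccontr)
    assume "B \<inter> B' \<noteq> {}"
    then obtain x where "x \<in> B" "x \<in> B'" by blast
    then have "x \<bullet> x = 0" "norm x = 1" using cross B(3) by auto
    then show False by simp
  qed
  have fin: "finite B" "finite B'" using B(4) B'(4) independent_imp_finite by auto
  have "dim L' + dim L = dim (UNIV :: (real ^ 'n) set)"
    unfolding L'_def using dim_subspace_orthogonal_to_vectors[OF assms subspace_UNIV] by simp
  then have card: "card (B \<union> B') = CARD('n)"
    using card_Un_disjoint[OF fin disj] B(5) B'(5) by simp
  then obtain \<beta> :: "'n \<Rightarrow> real ^ 'n" where \<beta>: "bij_betw \<beta> UNIV (B \<union> B')"
    using finite_same_card_bij[of "UNIV :: 'n set" "B \<union> B'"] fin by auto
  have in_B: "\<beta> i \<in> B \<union> B'" for i using \<beta> by (auto simp: bij_betw_def)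
  have orth: "x \<bullet> y = 0" if "x \<in> B \<union> B'" "y \<in> B \<union> B'" "x \<noteq> y" for x y
    using that cross[of x y] cross[of y x] B(2) B'(2)
    by (auto simp: pairwise_def orthogonal_def inner_commute)
  have orthonormal: "\<beta> i \<bullet> \<beta> j = (if i = j then 1 else 0)" for i j
  proof (cases "i = j")
    case True
    have "norm (\<beta> i) = 1" using in_B[of i] B(3) B'(3) by auto
    then show ?thesis using True by (simp add: norm_eq_1)
  next
    case False
    then have "\<beta> i \<noteq> \<beta> j" using \<beta> by (auto simp: bij_betw_def inj_def)
    then show ?thesis using False orth in_B by simp
  qed
  have "independent (B \<union> B')"
  proof (rule pairwise_orthogonal_independent)
    show "pairwise orthogonal (B \<union> B')" using orth by (auto simp: pairwise_def orthogonal_def)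
    show "0 \<notin> B \<union> B'" using B(3) B'(3) by force
  qed
  then have span: "span (B \<union> B') = UNIV"
    using card_ge_dim_independent[of "B \<union> B'" UNIV] card by auto
  have expand: "x = (\<Sum>i\<in>UNIV. (x \<bullet> \<beta> i) *\<^sub>R \<beta> i)" for x
  proof -
    define y where "y = x - (\<Sum>i\<in>UNIV. (x \<bullet> \<beta> i) *\<^sub>R \<beta> i)"
    have "y \<bullet> \<beta> j = 0" for j
      by (simp add: y_def inner_diff_left inner_sum_left orthonormal if_distrib cong: if_cong)
    moreover have "\<exists>j. w = \<beta> j" if "w \<in> B \<union> B'" for w
      using that \<beta> by (auto simp: bij_betw_def)
    ultimately have "orthogonal y w" if "w \<in> B \<union> B'" for w
      using that by (metis orthogonal_def)
    then have "orthogonal y y" using orthogonal_to_span[of y "B \<union> B'" y] span by auto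
    then show ?thesis by (simp add: orthogonal_def y_def)
  qed
  have "\<beta> ` {i. \<beta> i \<in> B} = B" using \<beta> by (auto simp: bij_betw_def)
  then have "L = span (\<beta> ` {i. \<beta> i \<in> B})" using B(6) by simp
  moreover have "\<forall>i j. \<beta> i \<bullet> \<beta> j = (if i = j then 1 else 0)" using orthonormal by blast
  moreover have "\<forall>x. x = (\<Sum>i\<in>UNIV. (x \<bullet> \<beta> i) *\<^sub>R \<beta> i)" using expand by blast
  ultimately show thesis using that by blast
qed

section \<open>Charts\<close>

lemma norm_orthonormal_sum:
  fixes \<beta> :: "'n::finite \<Rightarrow> 'a::real_inner"
  assumes "\<And>i j. \<beta> i \<bullet> \<beta> j = (if i = j then 1 else 0)"
  shows "(norm (\<Sum>i\<in>A. r i *\<^sub>R \<beta> i))\<^sup>2 = (\<Sum>i\<in>A. (r i)\<^sup>2)"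
proof -
  have "finite A" by (rule finite)
  then show ?thesis
    unfolding power2_norm_eq_inner inner_sum_left inner_sum_right
    by (simp add: assms if_distrib power2_eq_square cong: if_cong)
qed

section \<open>Normal form of the minimum in linear coordinates\<close>

lemma min_of_convex_normal_form:
  fixes h :: "'i \<Rightarrow> real ^ 'n \<Rightarrow> real"
  assumes fin: "finite I" "I \<noteq> {}" and conv: "\<And>i. i \<in> I \<Longrightarrow> convex_function_on S (h i)"
    and q: "q \<in> S" and val: "\<And>i. i \<in> I \<Longrightarrow> h i q = m"
  obtains r and \<Phi> :: "real ^ 'n \<Rightarrow> real ^ 'n" where
    "0 < r" "continuous_on (ball q r) \<Phi>" "inj_on \<Phi> (ball q r)"
    "(\<exists>k. \<forall>x\<in>ball q r. Min ((\<lambda>i. h i x) ` I) = \<Phi> x $ k) \<or>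
     \<Phi> q = 0 \<and> (\<exists>J. \<forall>x\<in>ball q r. Min ((\<lambda>i. h i x) ` I) - m =
       (\<Sum>i\<in>-J. (\<Phi> x $ i)\<^sup>2) - (\<Sum>i\<in>J. (\<Phi> x $ i)\<^sup>2))"
proof -
  define a where "a = (\<lambda>i. grad (h i) q)"
  obtain v0 \<kappa> where v0: "v0 = 0 \<or> norm v0 = 1" "\<forall>i\<in>I. 0 \<le> a i \<bullet> v0" and \<kappa>: "0 < \<kappa>"
    and neg: "\<forall>e\<in>span (a ` {i \<in> I. a i \<bullet> v0 = 0}). norm e = 1 \<longrightarrow>
      (\<exists>j\<in>{i \<in> I. a i \<bullet> v0 = 0}. a j \<bullet> e \<le> - \<kappa>)"
    by (rule maximal_ascent_direction[OF fin(1), of a])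
  define S0 where "S0 = {i \<in> I. a i \<bullet> v0 = 0}"
  \<comment> \<open>When all slopes along \<open>v0\<close> vanish, \<open>v0\<close> may still be a
    unit vector orthogonal to every gradient; it is discarded so that the rays stay
    straight.\<close>
  define v where "v = (if S0 = I then 0 else v0)"
  obtain \<beta> :: "'n \<Rightarrow> real ^ 'n" and J where \<beta>': "\<forall>i j. \<beta> i \<bullet> \<beta> j = (if i = j then 1 else 0)"
    "\<forall>x. x = (\<Sum>i\<in>UNIV. (x \<bullet> \<beta> i) *\<^sub>R \<beta> i)" and L: "span (a ` S0) = span (\<beta> ` J)"
    by (rule orthonormal_basis_adapted[OF subspace_span[of "a ` S0"]])
  have \<beta>: "\<beta> i \<bullet> \<beta> j = (if i = j then 1 else 0)" "x = (\<Sum>i\<in>UNIV. (x \<bullet> \<beta> i) *\<^sub>R \<beta> i)" for i j x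
    using \<beta>' by blast+
  define p where "p = (\<lambda>x. \<Sum>i\<in>J. (x \<bullet> \<beta> i) *\<^sub>R \<beta> i)"
  have lin_p: "linear p"
    by (auto simp: p_def linear_iff inner_add_left scaleR_add_left sum.distrib scaleR_sum_right)
  have p_\<beta>: "p x \<bullet> \<beta> j = (if j \<in> J then x \<bullet> \<beta> j else 0)" for x j
    by (simp add: p_def inner_sum_left \<beta>(1) if_distrib sum.If_cases cong: if_cong)
  have p_span: "p x \<in> span (a ` S0)" for x
    unfolding L p_def by (intro span_sum span_scale span_base) auto
  have p_fix: "p x = x" if "x \<in> span (a ` S0)" for x
  proof -
    have "span (\<beta> ` J) \<subseteq> {x. p x = x}"
    proof (rule span_minimal)
      show "subspace {x. p x = x}"
        using lin_p by (auto simp: subspace_def linear_0 linear_add linear_scale)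
      have "(\<beta> j \<bullet> \<beta> i) *\<^sub>R \<beta> i = (if j = i then \<beta> i else 0)" for i j by (simp add: \<beta>(1))
      then show "\<beta> ` J \<subseteq> {x. p x = x}" by (auto simp: p_def)
    qed
    then show ?thesis using that L by auto
  qed
  have p_sym: "p x \<bullet> y = x \<bullet> p y" for x y
    by (simp add: p_def inner_sum_left inner_sum_right inner_commute mult.commute)
  have p_v: "p v = 0"
  proof (cases "S0 = I")
    case True
    then show ?thesis using lin_p by (simp add: v_def linear_0)
  next
    case False
    have "orthogonal v0 w" if "w \<in> a ` S0" for w
      using that by (auto simp: S0_def orthogonal_def inner_commute)
    then have "orthogonal v0 (p v0)" using orthogonal_to_span p_span by blast
    then have "p v0 \<bullet> p v0 = 0" using p_sym[of v0 "p v0"] p_fix[OF p_span] by (simp add: orthogonal_def)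
    then show ?thesis using False by (simp add: v_def)
  qed
  obtain c C where cC: "0 < c" "0 < C"
    "\<forall>\<^sub>F x in nhds 0. \<forall>i\<in>I. strong_convexity_at c C S (h i) q x"
    using convex_functions_strong_convexity[of I S h q] fin(1) conv q by blast
  have S1_pos: "0 < a i \<bullet> v" if "i \<in> I - S0" for i
    using that v0(2) by (auto simp: S0_def v_def less_le)
  \<comment> \<open>The sum dominates each of its ratios. The summand 1 makes the inequalities
    strict, so that they persist for gradients near \<open>q\<close>.\<close>
  define M where "M = (\<Sum>i\<in>I - S0. norm (a i) / (a i \<bullet> v)) + 1"
  have "0 \<le> (\<Sum>i\<in>I - S0. norm (a i) / (a i \<bullet> v))"
    using S1_pos by (intro sum_nonneg divide_nonneg_pos) auto
  then have M: "0 < M" by (simp add: M_def)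
  have M_less: "norm (a i) < M * (a i \<bullet> v)" if i: "i \<in> I - S0" for i
  proof -
    have "norm (a i) / (a i \<bullet> v) \<le> (\<Sum>i\<in>I - S0. norm (a i) / (a i \<bullet> v))"
      using i fin S1_pos by (intro member_le_sum divide_nonneg_pos) auto
    then have "norm (a i) / (a i \<bullet> v) < M" by (simp add: M_def)
    then show ?thesis using S1_pos[OF i] by (simp add: pos_divide_less_eq)
  qed
  have ev1: "\<forall>\<^sub>F x in nhds 0. norm (grad (h i) (q + x)) < M * (grad (h i) (q + x) \<bullet> v)"
    if i: "i \<in> I - S0" for i
  proof -
    have "isCont (grad (h i)) q"
      using has_derivative_continuous[OF has_derivative_grad_hessian] convex_function_differentiable(2)[OF conv q] i
      by blast
    then have "isCont (\<lambda>x. grad (h i) (q + x)) 0" by (intro isCont_o2[where f = "\<lambda>x. q + x" and g = "grad (h i)"]) auto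
    then have G: "((\<lambda>x. grad (h i) (q + x)) \<longlongrightarrow> a i) (nhds 0)"
      using tendsto_at_iff_tendsto_nhds[where g = "\<lambda>x. grad (h i) (q + x)" and l = 0]
      by (simp add: isCont_def a_def)
    have "((\<lambda>x. M * (grad (h i) (q + x) \<bullet> v) - norm (grad (h i) (q + x))) \<longlongrightarrow> M * (a i \<bullet> v) - norm (a i)) (nhds 0)"
      by (intro tendsto_intros G)
    then have "\<forall>\<^sub>F x in nhds 0. 0 < M * (grad (h i) (q + x) \<bullet> v) - norm (grad (h i) (q + x))"
      using M_less[OF i] by (intro order_tendstoD(1)) auto
    then show ?thesis by (rule eventually_mono) simp
  qed
  have "\<forall>\<^sub>F x in nhds 0. \<forall>i\<in>I - S0. norm (grad (h i) (q + x)) < M * (grad (h i) (q + x) \<bullet> v)"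
    using ev1 fin by (subst eventually_ball_finite_distrib) auto
  from eventually_conj[OF cC(3) this] obtain \<delta>0 where \<delta>0: "0 < \<delta>0"
    "\<And>x i. norm x < \<delta>0 \<Longrightarrow> i \<in> I \<Longrightarrow> strong_convexity_at c C S (h i) q x"
    "\<And>x i. norm x < \<delta>0 \<Longrightarrow> i \<in> I - S0 \<Longrightarrow> norm (grad (h i) (q + x)) < M * (grad (h i) (q + x) \<bullet> v)"
    unfolding eventually_nhds_metric by (auto simp: dist_norm)
  define \<delta> where "\<delta> = min \<delta>0 (\<kappa> * c / (c + C) / (C * (1 + M)))"
  define \<eta> where "\<eta> = c / (2 * C)"
  have \<delta>: "0 < \<delta>" "\<delta> \<le> \<delta>0" using \<delta>0(1) \<kappa> cC M by (auto simp: \<delta>_def)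
  have "\<delta> * (C * (1 + M)) \<le> \<kappa> * c / (c + C) / (C * (1 + M)) * (C * (1 + M))"
    using cC M by (intro mult_right_mono) (auto simp: \<delta>_def)
  also have "\<dots> = \<kappa> * c / (c + C)" using cC M by simp
  finally have small: "C * \<delta> * (1 + M) \<le> \<kappa> * c / (c + C)" by (simp add: mult_ac)
  have \<eta>: "0 < \<eta>" "\<eta> * C < c" using cC by (auto simp: \<eta>_def)
  define g where "g = (\<lambda>i x. h i (q + x) - m)"
  define G where "G = (\<lambda>i x. grad (h i) (q + x))"
  interpret min_germ I g G S0 p v \<delta> c C \<kappa> M \<eta>
  proof (rule min_germ.intro)
    show "finite I" "I \<noteq> {}" "S0 \<subseteq> I" using fin by (auto simp: S0_def)
    show "0 < \<delta>" "0 < c" "0 < C" "0 < \<kappa>" "0 \<le> M" "0 \<le> \<eta>" using \<delta> cC \<kappa> M \<eta> by auto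
    show "g i 0 = 0" if "i \<in> I" for i using val[OF that] by (simp add: g_def)
    fix i and x :: "real ^ 'n" assume i: "i \<in> I" and "norm x < \<delta>"
    then have "norm x < \<delta>0" using \<delta> by simp
    from \<delta>0(2)[OF this i] have sc: "q + x \<in> S" "norm (G i x - G i 0) \<le> C * norm x"
      "G i 0 \<bullet> x + c * (norm x)\<^sup>2 \<le> g i x" "g i x + c * (norm x)\<^sup>2 \<le> G i x \<bullet> x"
      using val[OF i] by (auto simp: strong_convexity_at_def G_def g_def)
    then show "norm (G i x - G i 0) \<le> C * norm x" "G i 0 \<bullet> x + c * (norm x)\<^sup>2 \<le> g i x"
      "g i x + c * (norm x)\<^sup>2 \<le> G i x \<bullet> x" by auto
    have "(h i has_derivative (\<lambda>d. G i x \<bullet> d)) (at (q + x))"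
      unfolding G_def by (rule has_derivative_grad[OF convex_function_differentiable(1)[OF conv[OF i] sc(1)]])
    moreover have "((\<lambda>x. q + x) has_derivative (\<lambda>d. d)) (at x)" by (auto intro!: derivative_eq_intros)
    ultimately have "((\<lambda>x. h i (q + x)) has_derivative (\<lambda>d. G i x \<bullet> d)) (at x)"
      using has_derivative_compose[of "\<lambda>x. q + x" "\<lambda>d. d" x UNIV "h i"] by simp
    then show "(g i has_derivative (\<lambda>d. G i x \<bullet> d)) (at x)"
      unfolding g_def by (auto intro!: derivative_eq_intros)
  next
    show "linear p" by (rule lin_p)
    show "p (p x) = p x" for x by (rule p_fix[OF p_span])
    show "p x \<bullet> y = x \<bullet> p y" for x y by (rule p_sym)
    show "p v = 0" by (rule p_v)
    have "v0 \<noteq> 0" if "S0 \<noteq> I" using that by (auto simp: S0_def)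
    then show "v = 0 \<or> norm v = 1" using v0(1) by (auto simp: v_def)
    show "p (G i 0) = G i 0" if "i \<in> S0" for i
      using that by (intro p_fix span_base) (auto simp: G_def a_def)
    show "\<exists>j\<in>S0. G j 0 \<bullet> e \<le> - \<kappa>" if "p e = e" "norm e = 1" for e
      using neg p_span[of e] that by (simp add: S0_def G_def a_def)
    show "norm (G i x) < M * (G i x \<bullet> v)" if "i \<in> I - S0" "norm x < \<delta>" for i x
      using \<delta>0(3)[of x i] that \<delta> by (simp add: G_def)
    show "C * \<delta> * (1 + M) \<le> \<kappa> * c / (c + C)" "\<eta> * C < c" by fact+
  qed
  have min_eq: "Min ((\<lambda>i. h i x) ` I) = f (x - q) + m" for x
  proof (rule Min_eqI)
    show "finite ((\<lambda>i. h i x) ` I)" using fin by simp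
    show "f (x - q) + m \<le> y" if "y \<in> (\<lambda>i. h i x) ` I" for y
      using that f_le[of _ "x - q"] by (auto simp: g_def algebra_simps)
    obtain i where "i \<in> I" "f (x - q) = g i (x - q)" by (rule f_active)
    then show "f (x - q) + m \<in> (\<lambda>i. h i x) ` I" by (auto simp: g_def)
  qed
  have transfer: "continuous_on (ball q r) (\<lambda>x. T (\<Phi> (x - q)))" "inj_on (\<lambda>x. T (\<Phi> (x - q))) (ball q r)"
    if "continuous_on (ball 0 r) \<Phi>" "inj_on \<Phi> (ball 0 r)" "continuous_on UNIV T" "inj T"
    for r and \<Phi> T :: "real ^ 'n \<Rightarrow> real ^ 'n"
  proof -
    have "continuous_on (ball q r) (\<lambda>x. \<Phi> (x - q))"
      by (rule continuous_on_compose2[OF that(1)])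
        (auto intro!: continuous_intros simp: dist_norm norm_minus_commute)
    then show "continuous_on (ball q r) (\<lambda>x. T (\<Phi> (x - q)))"
      by (rule continuous_on_compose2[OF that(3)]) auto
    show "inj_on (\<lambda>x. T (\<Phi> (x - q))) (ball q r)"
    proof (rule inj_onI)
      fix x y assume "x \<in> ball q r" "y \<in> ball q r" "T (\<Phi> (x - q)) = T (\<Phi> (y - q))"
      then have "\<Phi> (x - q) = \<Phi> (y - q)" "x - q \<in> ball 0 r" "y - q \<in> ball 0 r"
        using injD[OF that(4)] by (auto simp: dist_norm norm_minus_commute)
      then have "x - q = y - q" by (rule inj_onD[OF that(2)])
      then show "x = y" by simp
    qed
  qed
  show thesis
  proof (cases "S0 = I")
    case True
    then have "v = 0" by (simp add: v_def)
    from critical_coordinates[OF True this] obtain \<Phi> where \<Phi>: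
      "continuous_on (ball 0 (\<delta> / (1 + \<eta>))) \<Phi>" "inj_on \<Phi> (ball 0 (\<delta> / (1 + \<eta>)))" "\<Phi> 0 = 0"
      "\<And>x. x \<in> ball 0 (\<delta> / (1 + \<eta>)) \<Longrightarrow> f x = (norm (\<Phi> x - p (\<Phi> x)))\<^sup>2 - (norm (p (\<Phi> x)))\<^sup>2"
      by blast
    \<comment> \<open>Coordinates with respect to \<beta>; \<open>p\<close> keeps exactly those in
      \<open>J\<close>.\<close>
    define T where "T = (\<lambda>x. \<chi> i. x \<bullet> \<beta> i)"
    have "continuous_on UNIV T" unfolding T_def by (intro continuous_intros)
    moreover have "inj T"
    proof (rule injI)
      fix x y assume "T x = T y"
      then have "x \<bullet> \<beta> i = y \<bullet> \<beta> i" for i by (simp add: T_def vec_eq_iff)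
      then show "x = y" using \<beta>(2)[of x] \<beta>(2)[of y] by simp
    qed
    ultimately have *: "continuous_on (ball q (\<delta> / (1 + \<eta>))) (\<lambda>x. T (\<Phi> (x - q)))"
      "inj_on (\<lambda>x. T (\<Phi> (x - q))) (ball q (\<delta> / (1 + \<eta>)))"
      using transfer \<Phi>(1,2) by blast+
    have np: "(norm (p y))\<^sup>2 = (\<Sum>i\<in>J. (T y $ i)\<^sup>2)" for y
      unfolding p_def by (simp add: norm_orthonormal_sum[OF \<beta>(1)] T_def)
    have nq: "(norm (y - p y))\<^sup>2 = (\<Sum>i\<in>-J. (T y $ i)\<^sup>2)" for y
    proof -
      have "y = (\<Sum>i\<in>-J. (y \<bullet> \<beta> i) *\<^sub>R \<beta> i) + p y"
        using \<beta>(2)[of y] sum.subset_diff[of J UNIV "\<lambda>i. (y \<bullet> \<beta> i) *\<^sub>R \<beta> i"]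
        by (simp add: p_def Compl_eq_Diff_UNIV)
      then have "y - p y = (\<Sum>i\<in>-J. (y \<bullet> \<beta> i) *\<^sub>R \<beta> i)" by (simp add: algebra_simps)
      then show ?thesis by (simp add: norm_orthonormal_sum[OF \<beta>(1)] T_def)
    qed
    show thesis
    proof (rule that[OF _ *], goal_cases)
      case 1
      then show ?case using \<delta> \<eta> by simp
    next
      case 2
      have "T 0 = 0" by (simp add: T_def vec_eq_iff)
      moreover have "Min ((\<lambda>i. h i x) ` I) - m =
          (\<Sum>i\<in>-J. (T (\<Phi> (x - q)) $ i)\<^sup>2) - (\<Sum>i\<in>J. (T (\<Phi> (x - q)) $ i)\<^sup>2)"
        if "x \<in> ball q (\<delta> / (1 + \<eta>))" for x
      proof -
        have "x - q \<in> ball 0 (\<delta> / (1 + \<eta>))" using that by (simp add: dist_norm norm_minus_commute)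
        then show ?thesis using \<Phi>(4) min_eq[of x] np nq by simp
      qed
      ultimately show ?case using \<Phi>(3) by auto
    qed
  next
    case False
    then have "v0 \<noteq> 0" by (auto simp: S0_def)
    then have v1: "norm v = 1" using v0(1) False by (simp add: v_def)
    from regular_coordinate[OF False v1 \<eta>(1)] obtain r \<Phi> where \<Phi>: "0 < r"
      "continuous_on (ball 0 r) \<Phi>" "inj_on \<Phi> (ball 0 r)" "\<And>x. x \<in> ball 0 r \<Longrightarrow> \<Phi> x \<bullet> v = f x"
      by blast
    fix k :: 'n
    have "norm v = norm (axis k 1 :: real ^ 'n)" using v1 by (simp add: norm_axis_1)
    then obtain R :: "real ^ 'n \<Rightarrow> real ^ 'n" where R: "orthogonal_transformation R" "R v = axis k 1"
      using orthogonal_transformation_exists by blast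
    \<comment> \<open>The rotation turns the component along \<open>v\<close> into coordinate
      \<open>k\<close>, an arbitrary index, and the shift by \<open>m\<close> makes that coordinate
      the minimum itself instead of its difference from \<open>m\<close>.\<close>
    define T where "T = (\<lambda>x. R x + axis k m)"
    have "continuous_on UNIV R"
      using orthogonal_transformation_linear[OF R(1)] linear_continuous_on linear_conv_bounded_linear by blast
    then have "continuous_on UNIV T"
      unfolding T_def by (rule continuous_on_add[OF _ continuous_on_const])
    moreover have "inj T" unfolding T_def using orthogonal_transformation_inj[OF R(1)] by (auto simp: inj_def)
    ultimately have *: "continuous_on (ball q r) (\<lambda>x. T (\<Phi> (x - q)))"
      "inj_on (\<lambda>x. T (\<Phi> (x - q))) (ball q r)"
      using transfer \<Phi>(2,3) by blast+
    have "Min ((\<lambda>i. h i x) ` I) = T (\<Phi> (x - q)) $ k" if "x \<in> ball q r" for x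
    proof -
      have "R y $ k = y \<bullet> v" for y
        using R by (metis cart_eq_inner_axis orthogonal_transformation_def)
      moreover have "x - q \<in> ball 0 r" using that by (simp add: dist_norm norm_minus_commute)
      ultimately show ?thesis using min_eq[of x] \<Phi>(4) by (simp add: T_def)
    qed
    then show thesis using that[OF \<Phi>(1) *] by blast
  qed
qed

text \<open>By invariance of domain \<Psi> is open on \<open>W\<close>, so continuity and
  injectivity suffice and no inverse has to be exhibited.\<close>

lemma chart_compose:
  fixes \<phi> :: "'a \<Rightarrow> real ^ 'n" and \<Psi> :: "real ^ 'n \<Rightarrow> real ^ 'n"
  assumes chart: "chart X U \<phi>" and W: "open W" "W \<subseteq> \<phi> ` U"
    and \<Psi>: "continuous_on W \<Psi>" "inj_on \<Psi> W"
  shows "chart X {u \<in> U. \<phi> u \<in> W} (\<Psi> \<circ> \<phi>)"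
proof -
  let ?V = "{u \<in> U. \<phi> u \<in> W}"
  have U: "openin X U" and hom: "homeomorphic_map (subtopology X U) (top_of_set (\<phi> ` U)) \<phi>"
    using chart by (auto simp: chart_def)
  have top: "topspace (subtopology X U) = U" using openin_subset[OF U] by auto
  have im: "\<phi> ` ?V = W" using W by auto
  have "continuous_map (subtopology X U) euclidean \<phi>"
    using homeomorphic_imp_continuous_map[OF hom] continuous_map_in_subtopology by blast
  from openin_continuous_map_preimage[OF this, of W] W(1)
  have "openin (subtopology X U) ?V" unfolding top by simp
  then have V: "openin X ?V" using U openin_trans_full by blast
  have "homeomorphic_map (subtopology (subtopology X U) ?V) (subtopology (top_of_set (\<phi> ` U)) W) \<phi>"
    using W by (intro homeomorphic_map_subtopologies_alt[OF hom]) (auto simp: top)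
  moreover have "U \<inter> ?V = ?V" "\<phi> ` U \<inter> W = W" using W by auto
  ultimately have 1: "homeomorphic_map (subtopology X ?V) (top_of_set W) \<phi>"
    by (simp add: subtopology_subtopology)
  have op: "open (\<Psi> ` A)" if "open A" "A \<subseteq> W" for A
    using that \<Psi> by (intro invariance_of_domain continuous_on_subset[OF \<Psi>(1)] inj_on_subset[OF \<Psi>(2)])
  have 2: "homeomorphic_map (top_of_set W) (top_of_set (\<Psi> ` W)) \<Psi>"
  proof (rule bijective_open_imp_homeomorphic_map)
    show "open_map (top_of_set W) (top_of_set (\<Psi> ` W)) \<Psi>"
      unfolding open_map_def using op W(1) op[OF W(1)]
      by (auto simp: openin_open_eq)
  qed (use \<Psi> in auto)
  have "(\<Psi> \<circ> \<phi>) ` ?V = \<Psi> ` W" using im by (metis image_comp)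
  then show ?thesis
    unfolding chart_def using V op[OF W(1)] homeomorphic_map_compose[OF 1 2] by simp
qed

text \<open>The negative squares of a critical point occupy the last places of a numbering, whereas
  the adapted basis yields an arbitrary set of indices.\<close>

lemma numbering_with_final_segment:
  fixes J :: "'n::finite set"
  obtains e where "bij_betw e {1..CARD('n)} (UNIV :: 'n set)"
    "bij_betw e {1..CARD('n) - card J} (-J)" "bij_betw e {CARD('n) - card J + 1..CARD('n)} J"
proof -
  let ?n = "CARD('n)"
  have le: "card J \<le> ?n" by (intro card_mono) auto
  have "card (- J) = ?n - card J" by (simp add: Compl_eq_Diff_UNIV card_Diff_subset)
  then obtain e1 where e1: "bij_betw e1 {1..?n - card J} (-J)"
    using finite_same_card_bij[of "{1..?n - card J}" "-J"] by auto
  obtain e2 where e2: "bij_betw e2 {?n - card J + 1..?n} J"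
    using finite_same_card_bij[of "{?n - card J + 1..?n}" J] le by auto
  define e where "e = (\<lambda>i. if i \<le> ?n - card J then e1 i else e2 i)"
  have 1: "bij_betw e {1..?n - card J} (-J)"
    using e1 by (subst bij_betw_cong[of _ _ e1]) (auto simp: e_def)
  have 2: "bij_betw e {?n - card J + 1..?n} J"
    using e2 by (subst bij_betw_cong[of _ _ e2]) (auto simp: e_def)
  have "{1..?n - card J} \<union> {?n - card J + 1..?n} = {1..?n}" by auto
  then have "bij_betw e {1..?n} (UNIV :: 'n set)" using bij_betw_combine[OF 1 2] by simp
  then show thesis using that 1 2 by blast
qed

section \<open>Global continuity and passage to the manifold\<close>

text \<open>Both local models are polynomials in chart coordinates, so continuity of
  \<open>f\<close> follows from the pointwise classification.\<close>

lemma regular_or_critical_imp_continuous: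
  assumes "regular_point TYPE('n::finite) X f x \<or> (\<exists>j. critical_point_of_index TYPE('n) X f j x)"
  shows "\<exists>U. openin X U \<and> x \<in> U \<and> continuous_map (subtopology X U) euclideanreal f"
proof -
  have cont: "continuous_map (subtopology X U) euclideanreal (\<lambda>y. \<phi> y $ k)"
    and open_U: "openin X U" and top: "topspace (subtopology X U) = U"
    if "chart X U \<phi>" for U and \<phi> :: "'a \<Rightarrow> real ^ 'n" and k
  proof -
    show "openin X U" using that by (simp add: chart_def)
    then show "topspace (subtopology X U) = U" using openin_subset by auto
    have "continuous_map (subtopology X U) euclidean \<phi>"
      using that homeomorphic_imp_continuous_map continuous_map_in_subtopology
      unfolding chart_def by blast
    then have "continuous_map (subtopology X U) euclidean ((\<lambda>y. y $ k) \<circ> \<phi>)"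
      by (rule continuous_map_compose) (auto intro: continuous_intros)
    then show "continuous_map (subtopology X U) euclideanreal (\<lambda>y. \<phi> y $ k)" by (simp add: o_def)
  qed
  show ?thesis
    using assms
  proof
    assume "regular_point TYPE('n) X f x"
    then obtain U and \<phi> :: "'a \<Rightarrow> real ^ 'n" and k where
      U: "chart X U \<phi>" "x \<in> U" "\<And>y. y \<in> U \<Longrightarrow> \<phi> y $ k = f y"
      unfolding regular_point_def by blast
    have "continuous_map (subtopology X U) euclideanreal f"
      by (rule continuous_map_eq[OF cont[OF U(1), of k]]) (use U(3) top[OF U(1)] in auto)
    then show ?thesis using open_U[OF U(1)] U(2) by blast
  next
    assume "\<exists>j. critical_point_of_index TYPE('n) X f j x"
    then obtain j U and \<phi> :: "'a \<Rightarrow> real ^ 'n" and e where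
      U: "chart X U \<phi>" "x \<in> U" "\<And>y. y \<in> U \<Longrightarrow> f y - f x =
           (\<Sum>i = 1..CARD('n) - j. (\<phi> y $ e i)\<^sup>2) - (\<Sum>i = CARD('n) - j + 1..CARD('n). (\<phi> y $ e i)\<^sup>2)"
      unfolding critical_point_of_index_def by blast
    have "continuous_map (subtopology X U) euclideanreal (\<lambda>y. f x +
        ((\<Sum>i = 1..CARD('n) - j. (\<phi> y $ e i)\<^sup>2) - (\<Sum>i = CARD('n) - j + 1..CARD('n). (\<phi> y $ e i)\<^sup>2)))"
      by (intro continuous_intros cont[OF U(1)]) auto
    then have "continuous_map (subtopology X U) euclideanreal f"
    proof (rule continuous_map_eq)
      fix y assume "y \<in> topspace (subtopology X U)"
      then have "y \<in> U" using top[OF U(1)] by simp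
      from U(3)[OF this] show "f x + ((\<Sum>i = 1..CARD('n) - j. (\<phi> y $ e i)\<^sup>2)
          - (\<Sum>i = CARD('n) - j + 1..CARD('n). (\<phi> y $ e i)\<^sup>2)) = f y" by linarith
    qed
    then show ?thesis using open_U[OF U(1)] U(2) by blast
  qed
qed

lemma continuous_map_of_local:
  assumes "\<And>x. x \<in> topspace X \<Longrightarrow> \<exists>U. openin X U \<and> x \<in> U \<and> continuous_map (subtopology X U) Y f"
  shows "continuous_map X Y f"
proof -
  obtain U where U: "\<And>x. x \<in> topspace X \<Longrightarrow> openin X (U x) \<and> x \<in> U x \<and> continuous_map (subtopology X (U x)) Y f"
    using assms by metis
  show ?thesis
    by (rule pasting_lemma[of "topspace X" X U Y "\<lambda>_. f"]) (use U in auto)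
qed

theorem theorem2:
  fixes X :: "'a topology"
    and fam :: "nat \<Rightarrow> 'a \<Rightarrow> real"
    and f :: "'a \<Rightarrow> real"
  assumes manifold: "topological_manifold X TYPE('n::finite)"
    and f_min: "\<And>x. x \<in> topspace X \<Longrightarrow> is_min_of (f x) {h x | h. h \<in> range fam}"
    and local_convex: "\<And>x. x \<in> topspace X \<Longrightarrow>
      \<exists>N Fx U (\<phi> :: 'a \<Rightarrow> real ^ 'n).
        x \<in> X interior_of N \<and>
        finite Fx \<and> Fx \<subseteq> range fam \<and>
        chart X U \<phi> \<and> N \<subseteq> U \<and>
        (\<forall>y\<in>N. is_min_of (f y) {h y | h. h \<in> Fx}) \<and>
        (\<forall>h\<in>Fx. convex_function_on (\<phi> ` U) (h \<circ> inv_into U \<phi>))"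
  shows "topological_Morse_function TYPE('n) X f"
proof -
  have reg_or_crit: "regular_point TYPE('n) X f x \<or> (\<exists>j. critical_point_of_index TYPE('n) X f j x)"
    if x: "x \<in> topspace X" for x
  proof -
    obtain N Fx U and \<phi> :: "'a \<Rightarrow> real ^ 'n" where
      N: "x \<in> X interior_of N" "N \<subseteq> U" and Fx: "finite Fx" and chart: "chart X U \<phi>"
      and min: "\<And>y. y \<in> N \<Longrightarrow> is_min_of (f y) {h y | h. h \<in> Fx}"
      and conv: "\<And>h. h \<in> Fx \<Longrightarrow> convex_function_on (\<phi> ` U) (h \<circ> inv_into U \<phi>)"
      using local_convex[OF x] by blast
    \<comment> \<open>The functions active at \<open>x\<close>. They share the value
      \<open>f x\<close> there, as the normal form requires, and the other members of
      \<open>Fx\<close> stay above them near \<open>x\<close>.\<close>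
    define I where "I = {h \<in> Fx. h x = f x}"
    define H where "H = (\<lambda>h :: 'a \<Rightarrow> real. h \<circ> inv_into U \<phi>)"
    define q where "q = \<phi> x"
    have xN: "x \<in> N" using N(1) interior_of_subset by fast
    then have xU: "x \<in> U" using N(2) by blast
    have inj: "inj_on \<phi> U"
    proof -
      have "openin X U" "homeomorphic_map (subtopology X U) (top_of_set (\<phi> ` U)) \<phi>"
        using chart by (auto simp: chart_def)
      moreover from this have "topspace (subtopology X U) = U" using openin_subset by auto
      ultimately show ?thesis using homeomorphic_imp_injective_map by metis
    qed
    have H_\<phi>: "H h (\<phi> y) = h y" if "y \<in> U" for h y using inj that by (simp add: H_def)
    have qU: "q \<in> \<phi> ` U" using xU by (simp add: q_def)
    have finI: "finite I" using Fx by (simp add: I_def)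
    obtain h0 where h0: "h0 \<in> I" using min[OF xN] by (force simp: is_min_of_def I_def)
    have open_N: "open (\<phi> ` (X interior_of N))"
    proof -
      have sub: "X interior_of N \<subseteq> U" using N(2) interior_of_subset by fast
      have "openin (subtopology X U) (X interior_of N)"
        using sub chart by (simp add: chart_def openin_open_subtopology)
      moreover have "homeomorphic_map (subtopology X U) (top_of_set (\<phi> ` U)) \<phi>" "open (\<phi> ` U)"
        using chart by (auto simp: chart_def)
      ultimately have "openin (top_of_set (\<phi> ` U)) (\<phi> ` (X interior_of N))"
        using homeomorphic_map_openness_eq by blast
      then show ?thesis using \<open>open (\<phi> ` U)\<close> openin_open_eq by blast
    qed
    have "\<forall>h\<in>Fx - I. \<forall>\<^sub>F w in nhds q. 0 < H h w - H h0 w"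
    proof
      fix h assume h: "h \<in> Fx - I"
      have "(H k \<longlongrightarrow> H k q) (nhds q)" if "k \<in> Fx" for k
      proof -
        have "isCont (H k) q"
          using convex_function_differentiable(1)[OF conv[OF that] qU] differentiable_imp_continuous_within
          by (auto simp: H_def)
        then show ?thesis by (simp add: isCont_def tendsto_at_iff_tendsto_nhds)
      qed
      then have "((\<lambda>w. H h w - H h0 w) \<longlongrightarrow> H h q - H h0 q) (nhds q)"
        using h h0 by (intro tendsto_diff) (auto simp: I_def)
      moreover have "H h q - H h0 q > 0"
      proof -
        have "f x \<le> h x" "h x \<noteq> f x" "h0 x = f x"
          using min[OF xN] h h0 by (auto simp: is_min_of_def I_def)
        then show ?thesis by (simp add: q_def H_\<phi>[OF xU])
      qed
      ultimately show "\<forall>\<^sub>F w in nhds q. 0 < H h w - H h0 w" by (intro order_tendstoD(1))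
    qed
    then have "\<forall>\<^sub>F w in nhds q. \<forall>h\<in>Fx - I. 0 < H h w - H h0 w"
      using Fx by (subst eventually_ball_finite_distrib) auto
    moreover have "\<forall>\<^sub>F w in nhds q. w \<in> \<phi> ` (X interior_of N)"
      using open_N N(1) by (intro eventually_nhds_in_open) (auto simp: q_def)
    ultimately obtain s where s: "0 < s" "\<And>w. dist w q < s \<Longrightarrow>
        w \<in> \<phi> ` (X interior_of N) \<and> (\<forall>h\<in>Fx - I. H h0 w < H h w)"
      using eventually_conj[of _ "nhds q"] unfolding eventually_nhds_metric by (smt (verit))
    have f_eq: "f y = Min ((\<lambda>h. H h (\<phi> y)) ` I)" if y: "y \<in> U" "dist (\<phi> y) q < s" for y
    proof -
      \<comment> \<open>Closeness is measured in the chart, so the point found in the interior of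
        \<open>N\<close> must be identified with \<open>y\<close> by injectivity of \<phi> on
        \<open>U\<close>.\<close>
      obtain y' where "y' \<in> X interior_of N" "\<phi> y = \<phi> y'" using s(2)[OF y(2)] by blast
      then have "y \<in> N" using N(2) y(1) inj interior_of_subset[of X N] by (metis inj_onD subsetD)
      from min[OF this] have "\<exists>k\<in>Fx. f y = k y" "\<forall>h\<in>Fx. f y \<le> h y"
        unfolding is_min_of_def by blast+
      then obtain k where k: "k \<in> Fx" "f y = k y" "\<And>h. h \<in> Fx \<Longrightarrow> f y \<le> h y" by blast
      have "h0 y < h y" if "h \<in> Fx - I" for h
        using s(2)[OF y(2)] that by (simp add: H_\<phi>[OF y(1)])
      then have "k \<in> I" using k(1,2) k(3)[of h0] h0 by (force simp: I_def)
      then have "Min ((\<lambda>h. h y) ` I) = f y"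
        using k finI by (intro Min_eqI) (auto simp: I_def)
      then show ?thesis by (simp add: H_\<phi>[OF y(1)])
    qed
    obtain r and \<Phi> :: "real ^ 'n \<Rightarrow> real ^ 'n" where r: "0 < r"
      and \<Phi>: "continuous_on (ball q r) \<Phi>" "inj_on \<Phi> (ball q r)"
      and cases: "(\<exists>k. \<forall>w\<in>ball q r. Min ((\<lambda>h. H h w) ` I) = \<Phi> w $ k) \<or>
        \<Phi> q = 0 \<and> (\<exists>J. \<forall>w\<in>ball q r. Min ((\<lambda>h. H h w) ` I) - f x =
          (\<Sum>i\<in>-J. (\<Phi> w $ i)\<^sup>2) - (\<Sum>i\<in>J. (\<Phi> w $ i)\<^sup>2))"
    proof (rule min_of_convex_normal_form[of I "\<phi> ` U" H q "f x"])
      show "finite I" "I \<noteq> {}" "q \<in> \<phi> ` U" using finI h0 qU by auto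
      show "convex_function_on (\<phi> ` U) (H h)" if "h \<in> I" for h
        using conv that by (simp add: I_def H_def)
      show "H h q = f x" if "h \<in> I" for h
        using that by (simp add: q_def H_\<phi>[OF xU] I_def)
    qed blast
    define W where "W = ball q (min r s)"
    define V where "V = {u \<in> U. \<phi> u \<in> W}"
    have "W \<subseteq> \<phi> ` U"
    proof
      fix w assume "w \<in> W"
      then have "w \<in> \<phi> ` (X interior_of N)" using s(2)[of w] by (simp add: W_def dist_commute)
      then show "w \<in> \<phi> ` U" using N(2) interior_of_subset[of X N] by blast
    qed
    then have new_chart: "chart X V (\<Phi> \<circ> \<phi>)"
      unfolding V_def
      by (intro chart_compose[OF chart])
        (auto simp: W_def intro: continuous_on_subset[OF \<Phi>(1)] inj_on_subset[OF \<Phi>(2)])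
    have xV: "x \<in> V" using xU r s(1) by (simp add: V_def W_def q_def)
    have V: "f y = Min ((\<lambda>h. H h (\<phi> y)) ` I)" "\<phi> y \<in> ball q r" if "y \<in> V" for y
      using that f_eq[of y] by (auto simp: V_def W_def dist_commute)
    show ?thesis
      using cases
    proof
      assume "\<exists>k. \<forall>w\<in>ball q r. Min ((\<lambda>h. H h w) ` I) = \<Phi> w $ k"
      then obtain k where "\<And>w. w \<in> ball q r \<Longrightarrow> Min ((\<lambda>h. H h w) ` I) = \<Phi> w $ k" by blast
      then have "\<forall>y\<in>V. (\<Phi> \<circ> \<phi>) y $ k = f y" using V by simp
      then show ?thesis using new_chart xV unfolding regular_point_def by blast
    next
      assume "\<Phi> q = 0 \<and> (\<exists>J. \<forall>w\<in>ball q r. Min ((\<lambda>h. H h w) ` I) - f x =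
          (\<Sum>i\<in>-J. (\<Phi> w $ i)\<^sup>2) - (\<Sum>i\<in>J. (\<Phi> w $ i)\<^sup>2))"
      then obtain J where \<Phi>0: "\<Phi> q = 0" and J: "\<And>w. w \<in> ball q r \<Longrightarrow> Min ((\<lambda>h. H h w) ` I) - f x =
          (\<Sum>i\<in>-J. (\<Phi> w $ i)\<^sup>2) - (\<Sum>i\<in>J. (\<Phi> w $ i)\<^sup>2)" by blast
      obtain e where e: "bij_betw e {1..CARD('n)} (UNIV :: 'n set)"
        "bij_betw e {1..CARD('n) - card J} (-J)" "bij_betw e {CARD('n) - card J + 1..CARD('n)} J"
        by (rule numbering_with_final_segment)
      have "f y - f x = (\<Sum>i = 1..CARD('n) - card J. ((\<Phi> \<circ> \<phi>) y $ e i)\<^sup>2)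
           - (\<Sum>i = CARD('n) - card J + 1..CARD('n). ((\<Phi> \<circ> \<phi>) y $ e i)\<^sup>2)" if "y \<in> V" for y
        using J[OF V(2)[OF that]] V(1)[OF that]
        by (simp only: o_def sum.reindex_bij_betw[OF e(2), of "\<lambda>i. (\<Phi> (\<phi> y) $ i)\<^sup>2"]
            sum.reindex_bij_betw[OF e(3), of "\<lambda>i. (\<Phi> (\<phi> y) $ i)\<^sup>2"])
      moreover have "card J \<le> CARD('n)" by (intro card_mono) auto
      moreover have "(\<Phi> \<circ> \<phi>) x = 0" using \<Phi>0 by (simp add: q_def)
      ultimately have "critical_point_of_index TYPE('n) X f (card J) x"
        unfolding critical_point_of_index_def using new_chart xV e(1) by blast
      then show ?thesis by blast
    qed
  qed
  then have "continuous_map X euclideanreal f"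
    by (intro continuous_map_of_local regular_or_critical_imp_continuous)
  then show ?thesis using reg_or_crit unfolding topological_Morse_function_def by blast
qed

end
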